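(* Let $\mathcal{D}=(D,Q)$ be a discriminant form of even signature, $k\in\mathbb{Z}$, $H_1,\dots,H_n$ isotropic subgroups of $D$, $D_i=H_i^\perp/H_i$, and $F\in S_k(\mathcal{D})$ with evaluation map $\mathcal{F}:\mathbb{C}[D]\to\{\mathbb{H}\to\mathbb{C}\}$, $\mathfrak{e}_\gamma\mapsto F_\gamma$. Then $F$ is an oldform w.r.t. $H_1,\dots,H_n$ $\iff$ $F\in\operatorname{image}(\uparrow^{\mathrm{func}})$ $\iff$ $\ker(\downarrow)\subseteq\ker(\mathcal{F})$; and $F$ is a newform w.r.t. $H_1,\dots,H_n$ $\iff$ $F\in\operatorname{image}(\uparrow^{\mathrm{func}})^\perp$ $\iff$ $\operatorname{image}(\uparrow)\subseteq\ker(\mathcal{F})$ $\iff$ for all $i=1,\dots,n$ and all $\gamma\in H_i^\perp$, $\sum_{h\in H_i}F_{\gamma+h}=0$.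
   Context: Discriminant form $\mathcal{D}=(D,Q)$: finite abelian group with $Q:D\to\mathbb{Q}/\mathbb{Z}$, $Q(a\gamma)=a^2Q(\gamma)$, $(\gamma,\delta)=Q(\gamma+\delta)-Q(\gamma)-Q(\delta)$ nondegenerate bilinear; $e(x)=\exp(2\pi ix)$, signature via $\sum_\gamma e(Q(\gamma))=\sqrt{|D|}e(\operatorname{sign}/8)$; level $N$ = smallest $m$ with $mQ(D)=0$. Weil representation $\rho$ on $\mathbb{C}[D]$: $\rho(T)\mathfrak{e}_\gamma=e(Q(\gamma))\mathfrak{e}_\gamma$, $\rho(S)\mathfrak{e}_\gamma=\frac{e(-\operatorname{sign}/8)}{\sqrt{|D|}}\sum_\beta e(-(\gamma,\beta))\mathfrak{e}_\beta$. $M_k(\mathcal{D})$: holomorphic $F=\sum F_\gamma\mathfrak{e}_\gamma:\mathbb{H}\to\mathbb{C}[D]$ with $F(M\tau)=(c\tau+d)^k\rho(M)F(\tau)$ for $M\in\mathrm{SL}_2(\mathbb{Z})$, bounded at $\infty$; each $F_\gamma$ is then a modular form for $\Gamma(N)$. $S_k(\mathcal{D})$: those $F$ all of whose components are cusp forms. Petersson product on $S_k(\mathcal{D})$: $\langle F,G\rangle=\int_{\mathcal{A}}\sum_\gamma F_\gamma\overline{G_\gamma}\,y^k\,dx\,dy/y^2$, $\mathcal{A}$ a fundamental domain for $\mathrm{SL}_2(\mathbb{Z})$. Isotropic $H$: $Q(H)=0$; $\mathcal{D}_H=(H^\perp/H,Q_H)$. Algebraic maps: $\downarrow_H:\mathbb{C}[D]\to\mathbb{C}[D_H]$,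 $\mathfrak{e}_\gamma\mapsto\mathfrak{e}_{\gamma+H}$ if $\gamma\in H^\perp$, else $0$; $\uparrow_H:\mathbb{C}[D_H]\to\mathbb{C}[D]$, $\mathfrak{e}_\alpha\mapsto\sum_{\gamma\in\alpha}\mathfrak{e}_\gamma$. $\downarrow=(\downarrow_{H_1},\dots,\downarrow_{H_n}):\mathbb{C}[D]\to\bigoplus_i\mathbb{C}[D_i]$, $\uparrow=\sum_i\uparrow_{H_i}:\bigoplus_i\mathbb{C}[D_i]\to\mathbb{C}[D]$. Functional maps: for $G=\sum_\alpha G_\alpha\mathfrak{e}_\alpha$, $G\!\uparrow_H^{\mathrm{func}}=\sum_{\gamma\in H^\perp}G_{\gamma+H}\mathfrak{e}_\gamma$; $\uparrow^{\mathrm{func}}:\bigoplus_i S_k(\mathcal{D}_{H_i})\to S_k(\mathcal{D})$, $(G_1,\dots,G_n)\mapsto\sum_i G_i\!\uparrow^{\mathrm{func}}_{H_i}$. Oldforms w.r.t. $H_1,\dots,H_n$: elements of $\sum_i S_k(\mathcal{D}_{H_i})\!\uparrow^{\mathrm{func}}_{H_i}$; newforms: its orthogonal complement in $S_k(\mathcal{D})$ w.r.t. the Petersson product. *)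

theory Defs
  imports "HOL-Algebra.Coset" "HOL-Analysis.Analysis"
begin

section \<open>The group of rationals modulo the integers\<close>

quotient_type qmodz = rat / "\<lambda>x y :: rat. x - y \<in> \<int>"
proof (rule equivpI)
  show "reflp (\<lambda>x y :: rat. x - y \<in> \<int>)"
    by (simp add: reflp_def)
  show "symp (\<lambda>x y :: rat. x - y \<in> \<int>)"
    unfolding symp_def by (metis Ints_minus minus_diff_eq)
  show "transp (\<lambda>x y :: rat. x - y \<in> \<int>)"
    unfolding transp_def by (metis Ints_add add_diff_eq diff_add_cancel)
qed

instantiation qmodz :: ab_group_add
begin

lift_definition zero_qmodz :: qmodz is "0 :: rat" .

lift_definition plus_qmodz :: "qmodz \<Rightarrow> qmodz \<Rightarrow> qmodz" is "(+)"
  by (metis Ints_add add_diff_add)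

lift_definition uminus_qmodz :: "qmodz \<Rightarrow> qmodz" is "uminus"
  by (metis Ints_minus minus_diff_minus)

lift_definition minus_qmodz :: "qmodz \<Rightarrow> qmodz \<Rightarrow> qmodz" is "(-)"
proof -
  fix a b c d :: rat
  assume "a - b \<in> \<int>" "c - d \<in> \<int>"
  then have "(a - b) - (c - d) \<in> \<int>" by (rule Ints_diff)
  then show "(a - c) - (b - d) \<in> \<int>" by (simp add: algebra_simps)
qed

instance
  by standard (transfer; simp add: algebra_simps)+

end

lift_definition int_mult :: "int \<Rightarrow> qmodz \<Rightarrow> qmodz" is "\<lambda>a x. of_int a * x"
  by (metis Ints_mult Ints_of_int right_diff_distrib)

definition ee :: "real \<Rightarrow> complex" where
  "ee x = exp (2 * of_real pi * \<i> * of_real x)"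

lemma ee_of_int_add: "ee (x + of_int n) = ee x"
proof -
  have "exp (2 * of_real pi * \<i> * of_int n) = (1 :: complex)"
    using exp_integer_2pi[of "of_int n"] by (simp add: ac_simps)
  then show ?thesis
    by (simp add: ee_def distrib_left exp_add)
qed

lift_definition e_qmodz :: "qmodz \<Rightarrow> complex" is "\<lambda>x. ee (of_rat x)"
proof -
  fix x y :: rat
  assume "x - y \<in> \<int>"
  then obtain n where "x - y = of_int n" by (elim Ints_cases)
  then have "x = y + of_int n" by simp
  then show "ee (of_rat x) = ee (of_rat y)"
    by (simp add: of_rat_add ee_of_int_add)
qed

section \<open>Discriminant forms\<close>

text \<open>The finite abelian group is a HOL-Algebra group, hence written multiplicatively.\<close>

definition bform :: "('a, 'b) monoid_scheme \<Rightarrow> ('a \<Rightarrow> qmodz) \<Rightarrow> 'a \<Rightarrow> 'a \<Rightarrow> qmodz" where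
  "bform D Q \<gamma> \<delta> = Q (\<gamma> \<otimes>\<^bsub>D\<^esub> \<delta>) - Q \<gamma> - Q \<delta>"

locale discriminant_form = comm_group D for D (structure) +
  fixes Q :: "'a \<Rightarrow> qmodz"
  assumes finite_carrier: "finite (carrier D)"
    and Q_int_pow: "\<And>(a :: int) \<gamma>. \<gamma> \<in> carrier D \<Longrightarrow> Q (\<gamma> [^] a) = int_mult (a\<^sup>2) (Q \<gamma>)"
    and bform_mult: "\<And>\<gamma> \<gamma>' \<delta>. \<lbrakk>\<gamma> \<in> carrier D; \<gamma>' \<in> carrier D; \<delta> \<in> carrier D\<rbrakk> \<Longrightarrow>
          bform D Q (\<gamma> \<otimes> \<gamma>') \<delta> = bform D Q \<gamma> \<delta> + bform D Q \<gamma>' \<delta>"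
    and nondegenerate: "\<And>\<gamma>. \<lbrakk>\<gamma> \<in> carrier D; \<And>\<delta>. \<delta> \<in> carrier D \<Longrightarrow> bform D Q \<gamma> \<delta> = 0\<rbrakk> \<Longrightarrow> \<gamma> = \<one>"

text \<open>The signature is an element of the integers modulo 8; \<open>signature\<close> is its
  representative in \<open>{0..<8}\<close>.\<close>

definition has_signature :: "('a, 'b) monoid_scheme \<Rightarrow> ('a \<Rightarrow> qmodz) \<Rightarrow> int \<Rightarrow> bool" where
  "has_signature D Q s \<longleftrightarrow>
     (\<Sum>\<gamma>\<in>carrier D. e_qmodz (Q \<gamma>)) = of_real (sqrt (card (carrier D))) * ee (of_int s / 8)"

definition signature :: "('a, 'b) monoid_scheme \<Rightarrow> ('a \<Rightarrow> qmodz) \<Rightarrow> int" where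
  "signature D Q = (THE s. s \<in> {0..<8} \<and> has_signature D Q s)"

definition isotropic :: "('a, 'b) monoid_scheme \<Rightarrow> ('a \<Rightarrow> qmodz) \<Rightarrow> 'a set \<Rightarrow> bool" where
  "isotropic D Q H \<longleftrightarrow> subgroup H D \<and> (\<forall>\<gamma>\<in>H. Q \<gamma> = 0)"

definition perp :: "('a, 'b) monoid_scheme \<Rightarrow> ('a \<Rightarrow> qmodz) \<Rightarrow> 'a set \<Rightarrow> 'a set" where
  "perp D Q H = {\<gamma> \<in> carrier D. \<forall>\<delta>\<in>H. bform D Q \<gamma> \<delta> = 0}"

definition quot_group :: "('a, 'b) monoid_scheme \<Rightarrow> ('a \<Rightarrow> qmodz) \<Rightarrow> 'a set \<Rightarrow> 'a set monoid" where
  "quot_group D Q H = (D\<lparr>carrier := perp D Q H\<rparr>) Mod H"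

text \<open>For isotropic \<open>H\<close>, \<open>Q\<close> is constant on the cosets of \<open>H\<close> in its orthogonal complement.\<close>

definition quot_form :: "('a \<Rightarrow> qmodz) \<Rightarrow> 'a set \<Rightarrow> qmodz" where
  "quot_form Q \<alpha> = the_elem (Q ` \<alpha>)"

section \<open>The group algebra and the Weil representation\<close>

definition group_alg :: "('a, 'b) monoid_scheme \<Rightarrow> ('a \<Rightarrow> complex) set" where
  "group_alg D = {v. \<forall>\<gamma>. \<gamma> \<notin> carrier D \<longrightarrow> v \<gamma> = 0}"

definition basis_vec :: "'a \<Rightarrow> 'a \<Rightarrow> complex" where
  "basis_vec \<gamma> = (\<lambda>\<delta>. if \<delta> = \<gamma> then 1 else 0)"

text \<open>The linear extension of \<open>basis_vec \<gamma> \<mapsto> f \<gamma>\<close> to the group algebra.\<close>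

definition lin_ext :: "('a, 'b) monoid_scheme \<Rightarrow> ('a \<Rightarrow> 'c \<Rightarrow> complex) \<Rightarrow> ('a \<Rightarrow> complex) \<Rightarrow> 'c \<Rightarrow> complex" where
  "lin_ext D f v = (\<lambda>x. \<Sum>\<gamma>\<in>carrier D. v \<gamma> * f \<gamma> x)"

definition SL2Z :: "(int ^ 2 ^ 2) set" where
  "SL2Z = {M. det M = 1}"

definition S_mat :: "int ^ 2 ^ 2" where
  "S_mat = vector [vector [0, - 1], vector [1, 0]]"

definition T_mat :: "int ^ 2 ^ 2" where
  "T_mat = vector [vector [1, 1], vector [0, 1]]"

text \<open>Since \<open>S\<close> and \<open>T\<close> generate \<open>SL2Z\<close>, these conditions determine \<open>\<rho> M\<close> on the group algebra
  for every \<open>M \<in> SL2Z\<close>.\<close>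

definition weil_representation ::
  "('a, 'b) monoid_scheme \<Rightarrow> ('a \<Rightarrow> qmodz) \<Rightarrow> (int ^ 2 ^ 2 \<Rightarrow> ('a \<Rightarrow> complex) \<Rightarrow> 'a \<Rightarrow> complex) \<Rightarrow> bool" where
  "weil_representation D Q \<rho> \<longleftrightarrow>
     (\<forall>M\<in>SL2Z. \<forall>v\<in>group_alg D. \<rho> M v \<in> group_alg D) \<and>
     (\<forall>M\<in>SL2Z. \<forall>v\<in>group_alg D. \<forall>w\<in>group_alg D. \<forall>a b.
        \<rho> M (\<lambda>\<gamma>. a * v \<gamma> + b * w \<gamma>) = (\<lambda>\<gamma>. a * \<rho> M v \<gamma> + b * \<rho> M w \<gamma>)) \<and>
     (\<forall>v\<in>group_alg D. \<rho> (mat 1) v = v) \<and>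
     (\<forall>M\<in>SL2Z. \<forall>M'\<in>SL2Z. \<forall>v\<in>group_alg D. \<rho> (M ** M') v = \<rho> M (\<rho> M' v)) \<and>
     (\<forall>\<gamma>\<in>carrier D. \<rho> T_mat (basis_vec \<gamma>) = (\<lambda>\<delta>. e_qmodz (Q \<gamma>) * basis_vec \<gamma> \<delta>)) \<and>
     (\<forall>\<gamma>\<in>carrier D. \<rho> S_mat (basis_vec \<gamma>) =
        (\<lambda>\<delta>. ee (- of_int (signature D Q) / 8) / of_real (sqrt (card (carrier D))) *
              (\<Sum>\<beta>\<in>carrier D. e_qmodz (- bform D Q \<gamma> \<beta>) * basis_vec \<beta> \<delta>)))"

section \<open>Modular forms\<close>

definition upper_half :: "complex set" where
  "upper_half = {\<tau>. Im \<tau> > 0}"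

definition aut_factor :: "int ^ 2 ^ 2 \<Rightarrow> complex \<Rightarrow> complex" where
  "aut_factor M \<tau> = of_int (M $ 2 $ 1) * \<tau> + of_int (M $ 2 $ 2)"

definition moebius :: "int ^ 2 ^ 2 \<Rightarrow> complex \<Rightarrow> complex" where
  "moebius M \<tau> = (of_int (M $ 1 $ 1) * \<tau> + of_int (M $ 1 $ 2)) / aut_factor M \<tau>"

definition slash :: "int \<Rightarrow> (complex \<Rightarrow> complex) \<Rightarrow> int ^ 2 ^ 2 \<Rightarrow> complex \<Rightarrow> complex" where
  "slash k f M \<tau> = aut_factor M \<tau> powi (- k) * f (moebius M \<tau>)"

definition bounded_at_infinity :: "(complex \<Rightarrow> complex) \<Rightarrow> bool" where
  "bounded_at_infinity f \<longleftrightarrow> (\<exists>B C. \<forall>\<tau>\<in>upper_half. Im \<tau> \<ge> B \<longrightarrow> norm (f \<tau>) \<le> C)"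

definition vanishes_at_infinity :: "(complex \<Rightarrow> complex) \<Rightarrow> bool" where
  "vanishes_at_infinity f \<longleftrightarrow> (f \<longlongrightarrow> 0) (filtercomap Im at_top)"

definition Gamma_N :: "nat \<Rightarrow> (int ^ 2 ^ 2) set" where
  "Gamma_N N = {M \<in> SL2Z. \<forall>i j. int N dvd (M - mat 1) $ i $ j}"

definition modular_form :: "nat \<Rightarrow> int \<Rightarrow> (complex \<Rightarrow> complex) \<Rightarrow> bool" where
  "modular_form N k f \<longleftrightarrow>
     f holomorphic_on upper_half \<and>
     (\<forall>M\<in>Gamma_N N. \<forall>\<tau>\<in>upper_half. slash k f M \<tau> = f \<tau>) \<and>
     (\<forall>M\<in>SL2Z. bounded_at_infinity (slash k f M))"

definition cusp_form :: "nat \<Rightarrow> int \<Rightarrow> (complex \<Rightarrow> complex) \<Rightarrow> bool" where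
  "cusp_form N k f \<longleftrightarrow> modular_form N k f \<and> (\<forall>M\<in>SL2Z. vanishes_at_infinity (slash k f M))"

text \<open>A map from the upper half plane to the group algebra is a function \<open>F\<close> with \<open>F \<tau> \<gamma>\<close> the
  \<open>\<gamma>\<close>-component at \<open>\<tau>\<close>, extended by \<open>0\<close> to all \<open>\<tau>\<close>, so that equality of such maps is HOL equality.\<close>

definition vv_modular_forms ::
  "('a, 'b) monoid_scheme \<Rightarrow> ('a \<Rightarrow> qmodz) \<Rightarrow> int \<Rightarrow> (complex \<Rightarrow> 'a \<Rightarrow> complex) set" where
  "vv_modular_forms D Q k =
     {F. (\<forall>\<tau>. F \<tau> \<in> group_alg D) \<and>
         (\<forall>\<tau>. \<tau> \<notin> upper_half \<longrightarrow> F \<tau> = (\<lambda>\<gamma>. 0)) \<and>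
         (\<forall>\<gamma>\<in>carrier D. (\<lambda>\<tau>. F \<tau> \<gamma>) holomorphic_on upper_half) \<and>
         (\<exists>\<rho>. weil_representation D Q \<rho> \<and>
            (\<forall>M\<in>SL2Z. \<forall>\<tau>\<in>upper_half.
               F (moebius M \<tau>) = (\<lambda>\<gamma>. aut_factor M \<tau> powi k * \<rho> M (F \<tau>) \<gamma>))) \<and>
         (\<forall>\<gamma>\<in>carrier D. bounded_at_infinity (\<lambda>\<tau>. F \<tau> \<gamma>))}"

text \<open>The components of a vector-valued modular form are modular forms for the principal
  congruence subgroup of the level of \<open>D\<close>, and for a modular form the vanishing condition in
  \<open>cusp_form\<close> does not involve the level; so asking for some level is the same as asking
  for that one.\<close>

definition vv_cusp_forms ::
  "('a, 'b) monoid_scheme \<Rightarrow> ('a \<Rightarrow> qmodz) \<Rightarrow> int \<Rightarrow> (complex \<Rightarrow> 'a \<Rightarrow> complex) set" where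
  "vv_cusp_forms D Q k =
     {F \<in> vv_modular_forms D Q k. \<forall>\<gamma>\<in>carrier D. \<exists>N>0. cusp_form N k (\<lambda>\<tau>. F \<tau> \<gamma>)}"

definition fund_domain :: "complex set" where
  "fund_domain = {\<tau> \<in> upper_half. \<bar>Re \<tau>\<bar> \<le> 1 / 2 \<and> norm \<tau> \<ge> 1}"

definition petersson ::
  "('a, 'b) monoid_scheme \<Rightarrow> int \<Rightarrow> (complex \<Rightarrow> 'a \<Rightarrow> complex) \<Rightarrow> (complex \<Rightarrow> 'a \<Rightarrow> complex) \<Rightarrow> complex" where
  "petersson D k F G =
     (LINT \<tau>:fund_domain|lborel.
        (\<Sum>\<gamma>\<in>carrier D. F \<tau> \<gamma> * cnj (G \<tau> \<gamma>)) * of_real (Im \<tau> powi k / (Im \<tau>)\<^sup>2))"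

definition petersson_perp ::
  "('a, 'b) monoid_scheme \<Rightarrow> ('a \<Rightarrow> qmodz) \<Rightarrow> int \<Rightarrow> (complex \<Rightarrow> 'a \<Rightarrow> complex) set \<Rightarrow>
   (complex \<Rightarrow> 'a \<Rightarrow> complex) set" where
  "petersson_perp D Q k X = {F \<in> vv_cusp_forms D Q k. \<forall>G\<in>X. petersson D k F G = 0}"

section \<open>Arrow operators\<close>

definition down :: "('a, 'b) monoid_scheme \<Rightarrow> ('a \<Rightarrow> qmodz) \<Rightarrow> 'a set \<Rightarrow> ('a \<Rightarrow> complex) \<Rightarrow> 'a set \<Rightarrow> complex" where
  "down D Q H = lin_ext D (\<lambda>\<gamma>. if \<gamma> \<in> perp D Q H then basis_vec (H #>\<^bsub>D\<^esub> \<gamma>) else (\<lambda>\<alpha>. 0))"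

definition up :: "('a, 'b) monoid_scheme \<Rightarrow> ('a \<Rightarrow> qmodz) \<Rightarrow> 'a set \<Rightarrow> ('a set \<Rightarrow> complex) \<Rightarrow> 'a \<Rightarrow> complex" where
  "up D Q H = lin_ext (quot_group D Q H) (\<lambda>\<alpha> \<delta>. \<Sum>\<gamma>\<in>\<alpha>. basis_vec \<gamma> \<delta>)"

definition up_func ::
  "('a, 'b) monoid_scheme \<Rightarrow> ('a \<Rightarrow> qmodz) \<Rightarrow> 'a set \<Rightarrow> (complex \<Rightarrow> 'a set \<Rightarrow> complex) \<Rightarrow>
   complex \<Rightarrow> 'a \<Rightarrow> complex" where
  "up_func D Q H G = (\<lambda>\<tau> \<delta>. \<Sum>\<gamma>\<in>perp D Q H. G \<tau> (H #>\<^bsub>D\<^esub> \<gamma>) * basis_vec \<gamma> \<delta>)"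

text \<open>Elements of the direct sums over \<open>i = 1, \<dots>, n\<close> are extensional families on \<open>{1..n}\<close>.\<close>

definition down_all ::
  "('a, 'b) monoid_scheme \<Rightarrow> ('a \<Rightarrow> qmodz) \<Rightarrow> nat \<Rightarrow> (nat \<Rightarrow> 'a set) \<Rightarrow> ('a \<Rightarrow> complex) \<Rightarrow>
   nat \<Rightarrow> 'a set \<Rightarrow> complex" where
  "down_all D Q n H v = (\<lambda>i\<in>{1..n}. down D Q (H i) v)"

definition up_all ::
  "('a, 'b) monoid_scheme \<Rightarrow> ('a \<Rightarrow> qmodz) \<Rightarrow> nat \<Rightarrow> (nat \<Rightarrow> 'a set) \<Rightarrow> (nat \<Rightarrow> 'a set \<Rightarrow> complex) \<Rightarrow>
   'a \<Rightarrow> complex" where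
  "up_all D Q n H v = (\<lambda>\<gamma>. \<Sum>i=1..n. up D Q (H i) (v i) \<gamma>)"

definition up_func_all ::
  "('a, 'b) monoid_scheme \<Rightarrow> ('a \<Rightarrow> qmodz) \<Rightarrow> nat \<Rightarrow> (nat \<Rightarrow> 'a set) \<Rightarrow>
   (nat \<Rightarrow> complex \<Rightarrow> 'a set \<Rightarrow> complex) \<Rightarrow> complex \<Rightarrow> 'a \<Rightarrow> complex" where
  "up_func_all D Q n H G = (\<lambda>\<tau> \<gamma>. \<Sum>i=1..n. up_func D Q (H i) (G i) \<tau> \<gamma>)"

definition ker_down_all ::
  "('a, 'b) monoid_scheme \<Rightarrow> ('a \<Rightarrow> qmodz) \<Rightarrow> nat \<Rightarrow> (nat \<Rightarrow> 'a set) \<Rightarrow> ('a \<Rightarrow> complex) set" where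
  "ker_down_all D Q n H = {v \<in> group_alg D. down_all D Q n H v = (\<lambda>i\<in>{1..n}. \<lambda>\<alpha>. 0)}"

definition image_up_all ::
  "('a, 'b) monoid_scheme \<Rightarrow> ('a \<Rightarrow> qmodz) \<Rightarrow> nat \<Rightarrow> (nat \<Rightarrow> 'a set) \<Rightarrow> ('a \<Rightarrow> complex) set" where
  "image_up_all D Q n H = up_all D Q n H ` (\<Pi>\<^sub>E i\<in>{1..n}. group_alg (quot_group D Q (H i)))"

definition image_up_func_all ::
  "('a, 'b) monoid_scheme \<Rightarrow> ('a \<Rightarrow> qmodz) \<Rightarrow> int \<Rightarrow> nat \<Rightarrow> (nat \<Rightarrow> 'a set) \<Rightarrow>
   (complex \<Rightarrow> 'a \<Rightarrow> complex) set" where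
  "image_up_func_all D Q k n H =
     up_func_all D Q n H ` (\<Pi>\<^sub>E i\<in>{1..n}. vv_cusp_forms (quot_group D Q (H i)) (quot_form Q) k)"

definition eval_map :: "('a, 'b) monoid_scheme \<Rightarrow> (complex \<Rightarrow> 'a \<Rightarrow> complex) \<Rightarrow> ('a \<Rightarrow> complex) \<Rightarrow> complex \<Rightarrow> complex" where
  "eval_map D F = lin_ext D (\<lambda>\<gamma> \<tau>. F \<tau> \<gamma>)"

definition ker_eval_map :: "('a, 'b) monoid_scheme \<Rightarrow> (complex \<Rightarrow> 'a \<Rightarrow> complex) \<Rightarrow> ('a \<Rightarrow> complex) set" where
  "ker_eval_map D F = {v \<in> group_alg D. \<forall>\<tau>\<in>upper_half. eval_map D F v \<tau> = 0}"

definition oldforms ::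
  "('a, 'b) monoid_scheme \<Rightarrow> ('a \<Rightarrow> qmodz) \<Rightarrow> int \<Rightarrow> nat \<Rightarrow> (nat \<Rightarrow> 'a set) \<Rightarrow>
   (complex \<Rightarrow> 'a \<Rightarrow> complex) set" where
  "oldforms D Q k n H =
     {\<lambda>\<tau> \<gamma>. \<Sum>i=1..n. f i \<tau> \<gamma> | f.
        \<forall>i\<in>{1..n}. f i \<in> up_func D Q (H i) ` vv_cusp_forms (quot_group D Q (H i)) (quot_form Q) k}"

definition newforms ::
  "('a, 'b) monoid_scheme \<Rightarrow> ('a \<Rightarrow> qmodz) \<Rightarrow> int \<Rightarrow> nat \<Rightarrow> (nat \<Rightarrow> 'a set) \<Rightarrow>
   (complex \<Rightarrow> 'a \<Rightarrow> complex) set" where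
  "newforms D Q k n H = petersson_perp D Q k (oldforms D Q k n H)"

end

theory Submission
  imports Defs "HOL-Complex_Analysis.Complex_Analysis"
begin

text \<open>The maps \<open>\<up>\<^sub>H\<close> and \<open>\<down>\<^sub>H\<close> are adjoint and intertwine the Weil representations of \<open>D\<close> and
  \<open>H\<^sup>\<bottom>/H\<close>: this is checked on \<open>S\<close> and \<open>T\<close>, and the signatures agree because the Gauss sum of \<open>D\<close>
  is \<open>|H|\<close> times that of \<open>H\<^sup>\<bottom>/H\<close>. Let \<open>U = \<Sum>\<^sub>i \<up>\<^sub>i \<down>\<^sub>i\<close>. It is self-adjoint, its kernel is
  \<open>ker(\<down>)\<close>, and it has a pseudo-inverse \<open>A\<close> that is a polynomial in \<open>U\<close> and therefore commutes with
  the Weil representation. If \<open>ker(\<down>) \<subseteq> ker(F)\<close>, then \<open>F = U A F\<close>, so \<open>F\<close> is the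
  image of the cusp forms \<open>\<down>\<^sub>i A F\<close>. For newforms, \<open>\<langle>F, U F\<rangle>\<close> is the sum of the Petersson norms of the
  \<open>\<down>\<^sub>i F\<close>; it converges by the exponential decay of cusp forms, and its vanishing forces
  \<open>\<down>\<^sub>i F = 0\<close> by the identity theorem.\<close>

section \<open>Exponential decay of cusp forms\<close>

text \<open>\<open>eval_map\<close> pairs vectors without conjugation, so adjointness here means
  transposition. Positivity still becomes available because the arrow maps have real matrices and
  hence commute with conjugation: \<open>U\<close> has the shape \<open>B^T B\<close> with
  \<open>B\<close> real, which makes it symmetric and gives it no nilpotent part.

  \<open>vv_modular_forms\<close> hides the Weil representation behind an existential quantifier.
  The representation on \<open>H\<^sup>\<bottom>/H\<close> therefore has to be built from the
  particular \<rho> that belongs to \<open>F\<close>, and everything applied to \<open>F\<close> has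
  to commute with that same \<rho>.

  The identity \<open>F = U A F\<close> is obtained one coordinate at a time: the vector
  \<open>e_\<delta> - U A e_\<delta>\<close> lies in ker(\<down>), and pairing it with
  \<open>F \<tau>\<close> gives the \<delta>-coordinate of \<open>F - U A F\<close>.

  Convergence carries real weight in the newform part. A Bochner integral of a non-integrable
  function is 0 by convention, so a vanishing Petersson product says something only after
  integrability has been shown; as \<open>k\<close> is any integer, the decay of cusp forms has to
  absorb an arbitrary power of \<open>Im \<tau>\<close>.\<close>

lemma periodic_int:
  fixes f :: "complex \<Rightarrow> complex" and n :: int
  assumes per: "\<And>\<tau>. \<tau> \<in> upper_half \<Longrightarrow> f (\<tau> + of_nat N) = f \<tau>"
    and "\<tau> \<in> upper_half"
  shows "f (\<tau> + of_int n * of_nat N) = f \<tau>"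
proof -
  have up: "f (\<tau> + of_nat m * of_nat N) = f \<tau>" if "\<tau> \<in> upper_half" for m :: nat and \<tau>
  proof (induction m)
    case (Suc m)
    have "f (\<tau> + of_nat m * of_nat N + of_nat N) = f (\<tau> + of_nat m * of_nat N)"
      using that by (intro per) (simp add: upper_half_def)
    with Suc show ?case by (simp add: algebra_simps)
  qed simp
  show ?thesis
  proof (cases n rule: int_cases2)
    case (nonneg m)
    then show ?thesis using up[OF assms(2), of m] by simp
  next
    case (nonpos m)
    have "f (\<tau> - of_nat m * of_nat N + of_nat m * of_nat N) = f (\<tau> - of_nat m * of_nat N)"
      using assms(2) by (intro up) (simp add: upper_half_def)
    then show ?thesis using nonpos by simp
  qed
qed

lemma vanishes_at_infinityD:
  assumes "vanishes_at_infinity f" "e > 0"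
  obtains Y where "\<And>\<tau>. Im \<tau> \<ge> Y \<Longrightarrow> norm (f \<tau>) < e"
proof -
  have "eventually (\<lambda>\<tau>. dist (f \<tau>) 0 < e) (filtercomap Im at_top)"
    using assms unfolding vanishes_at_infinity_def by (auto dest: tendstoD)
  then show ?thesis
    using that by (auto simp: eventually_filtercomap_at_top_linorder)
qed

text \<open>The \<open>q\<close>-expansion of \<open>f\<close> extends holomorphically to the puncture with value \<open>0\<close> there.\<close>

lemma periodic_exponential_decay:
  fixes f :: "complex \<Rightarrow> complex"
  assumes hol: "f holomorphic_on upper_half" and "N > 0"
    and per: "\<And>\<tau>. \<tau> \<in> upper_half \<Longrightarrow> f (\<tau> + of_nat N) = f \<tau>"
    and van: "vanishes_at_infinity f"
  obtains a C Y where "a > 0" "\<And>\<tau>. Im \<tau> \<ge> Y \<Longrightarrow> norm (f \<tau>) \<le> C * exp (- a * Im \<tau>)"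
proof -
  \<comment> \<open>Inverse of \<open>w = 2 pi i \<tau> / N\<close>, where \<open>exp w\<close> is
    the local parameter \<open>q\<close> at a cusp of width \<open>N\<close>.\<close>
  define t where "t w = of_nat N * w / (2 * of_real pi * \<i>)" for w :: complex
  have Im_t: "Im (t w) = - of_nat N * Re w / (2 * pi)" for w
    by (simp add: t_def Im_divide field_simps power2_eq_square)
  have t_up: "t w \<in> upper_half" if "Re w < 0" for w
    using that \<open>N > 0\<close> by (simp add: upper_half_def Im_t mult_pos_neg divide_neg_pos)
  \<comment> \<open>The principal \<open>Ln\<close> jumps across the negative axis; by periodicity
    of \<open>f\<close> the choice of branch does not affect the value, which is the content of
    \<open>g_exp\<close>.\<close>
  define g where "g q = (if q = 0 then 0 else f (t (Ln q)))" for q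
  have g_exp: "g (exp w) = f (t w)" if "Re w < 0" for w
  proof -
    have "exp (Ln (exp w)) = exp w" by simp
    then obtain n :: int where n: "Ln (exp w) = w + of_int (2 * n) * of_real pi * \<i>"
      unfolding exp_eq by force
    have "t (Ln (exp w)) = t w + of_int n * of_nat N"
      unfolding n t_def by (simp add: field_simps)
    then show ?thesis
      using periodic_int[of f N "t w" n] per t_up[OF that] by (simp add: g_def)
  qed
  have "g analytic_on (ball 0 1 - {0})"
    unfolding analytic_on_def
  proof
    fix q0 :: complex
    assume q0: "q0 \<in> ball 0 1 - {0}"
    \<comment> \<open>The first bound keeps \<open>q / q0\<close> in the disc of radius 1 about 1,
      off the cut of \<open>Ln\<close>, so that \<open>L\<close> below is a holomorphic logarithm
      near \<open>q0\<close>; the second keeps \<open>q\<close> in the unit disc.\<close>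
    define r where "r = min (norm q0) (1 - norm q0)"
    have r: "r > 0" using q0 by (simp add: r_def)
    define L where "L q = Ln (q / q0) + Ln q0" for q
    have near: "Re (q / q0) > 0" "q \<noteq> 0" "norm q < 1" if "q \<in> ball q0 r" for q
    proof -
      have "norm (q - q0) < norm q0"
        using that by (simp add: r_def dist_norm norm_minus_commute)
      moreover have eq: "q / q0 - 1 = (q - q0) / q0"
        using q0 by (simp add: diff_divide_distrib)
      ultimately have "norm (q / q0 - 1) < 1"
        unfolding eq using q0 by (simp add: norm_divide)
      then show "Re (q / q0) > 0"
        using abs_Re_le_cmod[of "q / q0 - 1"] by simp
      then show "q \<noteq> 0" by auto
      have "norm q \<le> norm q0 + norm (q - q0)"
        using norm_triangle_ineq[of q0 "q - q0"] by simp
      also have "norm (q - q0) < 1 - norm q0"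
        using that by (simp add: r_def dist_norm norm_minus_commute)
      finally show "norm q < 1" by simp
    qed
    have expL: "exp (L q) = q" if "q \<in> ball q0 r" for q
      using near[OF that] q0 by (simp add: L_def exp_add)
    have ReL: "Re (L q) < 0" if "q \<in> ball q0 r" for q
    proof -
      have "exp (Re (L q)) < 1"
        using near[OF that] expL[OF that] norm_exp_eq_Re[of "L q"] by simp
      then show ?thesis by simp
    qed
    have "(\<lambda>q. f (t (L q))) holomorphic_on ball q0 r"
    proof (rule holomorphic_on_compose_gen[where g = f and f = "\<lambda>q. t (L q)", unfolded o_def])
      show "(\<lambda>q. t (L q)) holomorphic_on ball q0 r"
        unfolding t_def L_def using near(1) q0
        by (intro holomorphic_intros) (auto simp: complex_nonpos_Reals_iff not_le simp del: Re_divide)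
      show "(\<lambda>q. t (L q)) ` ball q0 r \<subseteq> upper_half"
        using t_up ReL by auto
    qed (rule hol)
    then have "g holomorphic_on ball q0 r"
      by (rule holomorphic_transform) (metis g_exp expL ReL)
    then show "\<exists>e>0. g holomorphic_on ball q0 e" using r by blast
  qed
  then have g_hol: "g holomorphic_on (ball 0 1 - {0})"
    by (rule analytic_imp_holomorphic)
  have "(g \<longlongrightarrow> 0) (at 0)"
  proof (rule tendstoI)
    fix e :: real assume "e > 0"
    then obtain Y where Y: "\<And>\<tau>. Im \<tau> \<ge> Y \<Longrightarrow> norm (f \<tau>) < e"
      using vanishes_at_infinityD[OF van] by metis
    \<comment> \<open>\<open>Im (t (Ln q))\<close> equals \<open>- N ln |q| / (2 pi)\<close>, so
      \<open>|q| < d\<close> pushes it above \<open>Y\<close>.\<close>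
    define d where "d = exp (- 2 * pi * Y / N)"
    have "norm (g q) < e" if "q \<noteq> 0" "norm q < d" for q
    proof -
      have "ln (norm q) < - 2 * pi * Y / N"
        using that unfolding d_def by (metis ln_exp ln_less_cancel_iff exp_gt_zero zero_less_norm_iff)
      then have "Im (t (Ln q)) \<ge> Y"
        using that \<open>N > 0\<close> by (simp add: Im_t Re_Ln field_simps)
      then show ?thesis using Y that by (simp add: g_def)
    qed
    then show "eventually (\<lambda>q. dist (g q) 0 < e) (at 0)"
      unfolding eventually_at by (intro exI[of _ d]) (auto simp: d_def)
  qed
  then have "g holomorphic_on ball 0 1"
    by (intro no_isolated_singularity'[OF _ g_hol])
       (auto simp: g_def at_within_open[of 0 "ball 0 1"])
  then have "g field_differentiable at 0"
    by (rule holomorphic_on_imp_differentiable_at) auto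
  then obtain D where "(g has_field_derivative D) (at 0)"
    by (auto simp: field_differentiable_def)
  \<comment> \<open>Since \<open>g 0 = 0\<close>, this is the difference quotient at the cusp. It
    bounds \<open>|g q|\<close> by a constant times \<open>|q|\<close>, and \<open>|q|\<close> is
    the desired \<open>exp (- a * Im \<tau>)\<close>.\<close>
  then have "((\<lambda>q. g q / q) \<longlongrightarrow> D) (at 0)"
    by (simp add: has_field_derivative_iff g_def)
  then have "((\<lambda>q. norm (g q / q)) \<longlongrightarrow> norm D) (at 0)"
    by (rule tendsto_norm)
  then have "eventually (\<lambda>q. norm (g q / q) < norm D + 1) (at 0)"
    by (rule order_tendstoD) simp
  then obtain d where d: "d > 0" "\<And>q. q \<noteq> 0 \<Longrightarrow> norm q < d \<Longrightarrow> norm (g q / q) < norm D + 1"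
    by (auto simp: eventually_at)
  define a where "a = 2 * pi / N"
  have "a > 0" using \<open>N > 0\<close> by (simp add: a_def)
  \<comment> \<open>The second entry forces \<open>|q| < d\<close>, the summand 1 making the
    inequality strict; the first keeps \<tau> in the upper half plane.\<close>
  define Y where "Y = max 1 (1 - ln d / a)"
  show ?thesis
  proof (rule that[OF \<open>a > 0\<close>])
    fix \<tau> assume \<tau>: "Im \<tau> \<ge> Y"
    define w where "w = 2 * of_real pi * \<i> * \<tau> / of_nat N"
    have Re_w: "Re w = - a * Im \<tau>"
      by (simp add: w_def a_def)
    have "Im \<tau> > 0" using \<tau> by (simp add: Y_def)
    have tw: "t w = \<tau>" using \<open>N > 0\<close> by (simp add: t_def w_def)
    have "- a * Im \<tau> < ln d"
      using \<tau> \<open>a > 0\<close> by (simp add: Y_def field_simps)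
    then have "norm (exp w) < d"
      using \<open>d > 0\<close> by (metis Re_w norm_exp_eq_Re exp_less_cancel_iff exp_ln)
    then have "norm (g (exp w) / exp w) < norm D + 1"
      using d(2) by simp
    then have "norm (g (exp w)) \<le> (norm D + 1) * norm (exp w)"
      by (simp add: norm_divide divide_simps)
    then show "norm (f \<tau>) \<le> (norm D + 1) * exp (- a * Im \<tau>)"
      using g_exp[of w] \<open>a > 0\<close> \<open>Im \<tau> > 0\<close> by (simp add: Re_w tw norm_exp_eq_Re)
  qed
qed

section \<open>Square integrability over the fundamental domain\<close>

lemma upper_half_open [simp]: "open upper_half"
  unfolding upper_half_def by (rule open_halfspace_Im_gt)

lemma cusp_form_periodic:
  assumes "cusp_form N k f" "\<tau> \<in> upper_half"
  shows "f (\<tau> + of_nat N) = f \<tau>"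
proof -
  define M :: "int ^ 2 ^ 2" where "M = vector [vector [1, int N], vector [0, 1]]"
  have "M \<in> Gamma_N N"
    by (simp add: Gamma_N_def SL2Z_def M_def det_2 forall_2 vector_2 mat_def)
  then have "slash k f M \<tau> = f \<tau>"
    using assms by (auto simp: cusp_form_def modular_form_def)
  then show ?thesis
    by (simp add: slash_def moebius_def aut_factor_def M_def vector_2)
qed

lemma slash_one [simp]: "slash k f (mat 1) \<tau> = f \<tau>"
  by (simp add: slash_def moebius_def aut_factor_def mat_def)

lemma mat_1_in_SL2Z [simp]: "mat 1 \<in> SL2Z"
  by (simp add: SL2Z_def)

lemma cusp_form_vanishes:
  assumes "cusp_form N k f" shows "vanishes_at_infinity f"
proof -
  have "vanishes_at_infinity (slash k f (mat 1))"
    using assms mat_1_in_SL2Z unfolding cusp_form_def by blast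
  then show ?thesis by (simp add: slash_one[abs_def])
qed

text \<open>The expansion at the cusp controls only large \<open>Im \<tau>\<close>. The rest of the
  half-strip is a compact rectangle inside the upper half plane, where \<open>f\<close> is bounded,
  and inflating that bound by \<open>exp (a * Y)\<close> compensates for the decaying factor
  there.\<close>

lemma cusp_form_decay:
  assumes cusp: "cusp_form N k f" and "N > 0"
  obtains a C where "a > 0" "C \<ge> 0"
    "\<And>\<tau>. \<bar>Re \<tau>\<bar> \<le> 1 / 2 \<Longrightarrow> Im \<tau> \<ge> 1 / 2 \<Longrightarrow> norm (f \<tau>) \<le> C * exp (- a * Im \<tau>)"
proof -
  have hol: "f holomorphic_on upper_half"
    using cusp by (simp add: cusp_form_def modular_form_def)
  obtain a C Y where a: "a > 0" and C: "\<And>\<tau>. Im \<tau> \<ge> Y \<Longrightarrow> norm (f \<tau>) \<le> C * exp (- a * Im \<tau>)"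
    using periodic_exponential_decay[OF hol \<open>N > 0\<close> cusp_form_periodic[OF cusp] cusp_form_vanishes[OF cusp]]
    by metis
  define K where "K = cbox (Complex (- 1 / 2) (1 / 2)) (Complex (1 / 2) Y)"
  have K: "\<tau> \<in> K \<longleftrightarrow> \<bar>Re \<tau>\<bar> \<le> 1 / 2 \<and> Im \<tau> \<ge> 1 / 2 \<and> Im \<tau> \<le> Y" for \<tau>
    by (auto simp: K_def in_cbox_complex_iff)
  have "K \<subseteq> upper_half" by (auto simp: K upper_half_def)
  then have "compact (f ` K)"
    using holomorphic_on_imp_continuous_on[OF hol]
    by (intro compact_continuous_image) (auto simp: K_def intro: continuous_on_subset)
  then obtain B where B: "\<And>\<tau>. \<tau> \<in> K \<Longrightarrow> norm (f \<tau>) \<le> B"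
    using compact_imp_bounded bounded_iff by (metis imageI)
  show ?thesis
  proof (rule that[of a "\<bar>C\<bar> + \<bar>B\<bar> * exp (a * Y)"])
    fix \<tau> assume \<tau>: "\<bar>Re \<tau>\<bar> \<le> 1 / 2" "Im \<tau> \<ge> 1 / 2"
    show "norm (f \<tau>) \<le> (\<bar>C\<bar> + \<bar>B\<bar> * exp (a * Y)) * exp (- a * Im \<tau>)"
    proof (cases "Im \<tau> \<le> Y")
      case True
      have "norm (f \<tau>) \<le> \<bar>B\<bar> * 1"
        using B[of \<tau>] True \<tau> by (simp add: K)
      also have "1 \<le> exp (a * Y) * exp (- a * Im \<tau>)"
        using a True by (simp flip: exp_add)
      finally have "norm (f \<tau>) \<le> \<bar>B\<bar> * (exp (a * Y) * exp (- a * Im \<tau>))"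
        by (simp add: mult_left_mono)
      then show ?thesis by (simp add: algebra_simps)
        (smt (verit, best) exp_gt_zero zero_le_mult_iff abs_ge_zero)
    next
      case False
      then have "norm (f \<tau>) \<le> C * exp (- a * Im \<tau>)" by (intro C) simp
      also have "\<dots> \<le> (\<bar>C\<bar> + \<bar>B\<bar> * exp (a * Y)) * exp (- a * Im \<tau>)"
        by (intro mult_right_mono) (auto intro: add_increasing2)
      finally show ?thesis .
    qed
  qed (use a in auto)
qed

text \<open>For \<open>y \<ge> 1 / 2\<close> both \<open>y\<close> and its inverse are at most
  \<open>4 * y\<close>, which reduces negative exponents to positive ones; then
  \<open>x \<le> exp x\<close> at \<open>x = a * y / j\<close> is raised to the power
  \<open>j\<close>. The choice \<open>j = |m| + 1\<close> keeps \<open>j\<close> positive.\<close>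

lemma powi_le_exp:
  fixes a :: real and m :: int
  assumes "a > 0"
  obtains C where "C \<ge> 0" "\<And>y. y \<ge> 1 / 2 \<Longrightarrow> y powi m \<le> C * exp (a * y)"
proof -
  define j where "j = nat \<bar>m\<bar> + 1"
  have "j > 0" by (simp add: j_def)
  show ?thesis
  proof (rule that[of "2 ^ j * (2 * j / a) ^ j"])
    fix y :: real assume y: "y \<ge> 1 / 2"
    have eq: "2 ^ i * (2 * y) ^ i = (2 * (2 * y)) ^ i" for i
      by (rule power_mult_distrib[symmetric])
    have "y powi m \<le> 2 ^ nat \<bar>m\<bar> * (2 * y) ^ nat \<bar>m\<bar>"
    proof (cases "m \<ge> 0")
      case True
      have "y ^ nat m \<le> (2 * (2 * y)) ^ nat m"
        using y by (intro power_mono) auto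
      moreover have "y powi m = y ^ nat m" "nat \<bar>m\<bar> = nat m"
        using True by (simp_all add: power_int_def)
      ultimately show ?thesis by (simp only: eq)
    next
      case False
      have "inverse y \<le> 2 * (2 * y)"
      proof -
        have "inverse y \<le> 2" using y by (simp add: field_simps)
        then show ?thesis using y by linarith
      qed
      then have "inverse y ^ nat (- m) \<le> (2 * (2 * y)) ^ nat (- m)"
        using y by (intro power_mono) auto
      moreover have "y powi m = inverse y ^ nat (- m)" "nat \<bar>m\<bar> = nat (- m)"
        using False by (simp_all add: power_int_def)
      ultimately show ?thesis by (simp only: eq)
    qed
    also have "\<dots> \<le> 2 ^ j * (2 * y) ^ j"
      using y by (intro mult_mono power_increasing) (auto simp: j_def)
    also have "\<dots> \<le> 2 ^ j * ((2 * j / a) ^ j * exp (a * y))"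
    proof (rule mult_left_mono)
      have "a * y / j \<le> exp (a * y / j)"
        using exp_ge_add_one_self[of "a * y / j"] by linarith
      then have "(a * y / j) ^ j \<le> exp (a * y / j) ^ j"
        using y assms by (intro power_mono) auto
      also have "\<dots> = exp (a * y)"
        using \<open>j > 0\<close> by (simp flip: exp_of_nat_mult)
      finally have "(2 * j / a) ^ j * (a * y / j) ^ j \<le> (2 * j / a) ^ j * exp (a * y)"
        using assms by (intro mult_left_mono) auto
      moreover have "2 * y = 2 * j / a * (a * y / j)"
        using assms \<open>j > 0\<close> by simp
      ultimately show "(2 * y) ^ j \<le> (2 * j / a) ^ j * exp (a * y)"
        by (simp only: power_mult_distrib)
    qed simp
    finally show "y powi m \<le> 2 ^ j * (2 * j / a) ^ j * exp (a * y)"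
      by (simp only: mult.assoc)
  qed (use assms in auto)
qed

text \<open>The half-strip is cut into the unit squares \<open>B n\<close> of area 1. On the
  \<open>n\<close>-th one the function is at most \<open>C * exp (- a) ^ n\<close>, so the integral
  is dominated by a geometric series.\<close>

lemma integrable_exponential_decay_strip:
  fixes g :: "complex \<Rightarrow> real"
  assumes "g \<in> borel_measurable lborel" "a > 0" "C \<ge> 0"
    and supp: "\<And>\<tau>. g \<tau> \<noteq> 0 \<Longrightarrow> \<bar>Re \<tau>\<bar> \<le> 1 / 2 \<and> Im \<tau> \<ge> 0"
    and bound: "\<And>\<tau>. \<bar>g \<tau>\<bar> \<le> C * exp (- a * Im \<tau>)"
  shows "integrable lborel g"
  unfolding integrable_iff_bounded
proof
  define B where "B n = cbox (Complex (- 1 / 2) (real n)) (Complex (1 / 2) (real n + 1))" for n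
  define c where "c n = C * exp (- a) ^ n" for n
  have c: "c n \<ge> 0" for n using assms by (simp add: c_def)
  have em: "emeasure lborel (B n) = 1" for n
    unfolding B_def by (subst emeasure_lborel_cbox) (auto simp: Basis_complex_def)
  have "summable c"
    unfolding c_def using \<open>a > 0\<close> by (intro summable_mult summable_geometric) simp
  have "(\<integral>\<^sup>+ \<tau>. ennreal (norm (g \<tau>)) \<partial>lborel) \<le> (\<integral>\<^sup>+ \<tau>. (\<Sum>n. ennreal (c n) * indicator (B n) \<tau>) \<partial>lborel)"
  proof (rule nn_integral_mono)
    fix \<tau>
    show "ennreal (norm (g \<tau>)) \<le> (\<Sum>n. ennreal (c n) * indicator (B n) \<tau>)"
    proof (cases "g \<tau> = 0")
      case False
      define n where "n = nat \<lfloor>Im \<tau>\<rfloor>"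
      have n: "real n \<le> Im \<tau>" "Im \<tau> \<le> real n + 1"
        using supp[OF False] by (auto simp: n_def)
      then have "\<tau> \<in> B n" using supp[OF False] by (auto simp: B_def in_cbox_complex_iff)
      have "\<bar>g \<tau>\<bar> \<le> C * exp (- a * Im \<tau>)" by (rule bound)
      also have "\<dots> \<le> C * exp (- a * n)" using assms n by (intro mult_left_mono) auto
      also have "\<dots> = c n" by (simp add: c_def mult.commute flip: exp_of_nat_mult)
      finally have "ennreal (norm (g \<tau>)) \<le> ennreal (c n) * indicator (B n) \<tau>"
        using \<open>\<tau> \<in> B n\<close> by (simp add: ennreal_leI)
      also have "\<dots> \<le> (\<Sum>n. ennreal (c n) * indicator (B n) \<tau>)"
        using sum_le_suminf[of "\<lambda>n. ennreal (c n) * indicator (B n) \<tau>" "{n}"]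
        by (simp del: sum_mult_indicator)
      finally show ?thesis .
    qed simp
  qed
  also have "\<dots> = (\<Sum>n. ennreal (c n) * emeasure lborel (B n))"
    by (subst nn_integral_suminf) (auto simp: nn_integral_cmult_indicator B_def)
  also have "\<dots> = ennreal (suminf c)"
    using \<open>summable c\<close> c by (simp add: em suminf_ennreal2)
  also have "\<dots> < \<infinity>" by simp
  finally show "(\<integral>\<^sup>+ \<tau>. ennreal (norm (g \<tau>)) \<partial>lborel) < \<infinity>" .
qed (use assms in auto)

lemma fund_domain_strip:
  assumes "\<tau> \<in> fund_domain" shows "\<bar>Re \<tau>\<bar> \<le> 1 / 2" "Im \<tau> \<ge> 1 / 2"
proof -
  show Re: "\<bar>Re \<tau>\<bar> \<le> 1 / 2" using assms by (simp add: fund_domain_def)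
  have "norm \<tau> \<le> \<bar>Re \<tau>\<bar> + \<bar>Im \<tau>\<bar>" by (rule cmod_le)
  then show "Im \<tau> \<ge> 1 / 2" using assms Re by (auto simp: fund_domain_def upper_half_def)
qed

lemma fund_domain_sets [measurable, simp]: "fund_domain \<in> sets borel"
proof -
  have "fund_domain = upper_half \<inter> {\<tau>. \<bar>Re \<tau>\<bar> \<le> 1 / 2} \<inter> {\<tau>. norm \<tau> \<ge> 1}"
    by (auto simp: fund_domain_def)
  moreover have "closed {\<tau>. \<bar>Re \<tau>\<bar> \<le> 1 / 2}" "closed {\<tau> :: complex. norm \<tau> \<ge> 1}"
    by (intro closed_Collect_le continuous_intros)+
  ultimately show ?thesis
    by (metis sets.Int borel_open borel_closed upper_half_open)
qed

text \<open>The square of \<open>f\<close> decays like \<open>exp (- 2 * a * Im \<tau>)\<close>. One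
  of the two factors \<open>exp (- a * Im \<tau>)\<close> is spent on the weight
  \<open>Im \<tau> powi (k - 2)\<close>, the other remains for integrability.\<close>

lemma cusp_form_square_integrable:
  assumes cusp: "cusp_form N k f" and "N > 0"
  shows "integrable lborel
    (\<lambda>\<tau>. indicator fund_domain \<tau> * ((norm (f \<tau>))\<^sup>2 * (Im \<tau> powi k / (Im \<tau>)\<^sup>2)))"
proof -
  obtain a C where a: "a > 0" and C: "C \<ge> 0"
    and decay: "\<And>\<tau>. \<bar>Re \<tau>\<bar> \<le> 1 / 2 \<Longrightarrow> Im \<tau> \<ge> 1 / 2 \<Longrightarrow> norm (f \<tau>) \<le> C * exp (- a * Im \<tau>)"
    using cusp_form_decay[OF assms] by metis
  obtain C' where C': "C' \<ge> 0" "\<And>y. y \<ge> 1 / 2 \<Longrightarrow> y powi (k - 2) \<le> C' * exp (a * y)"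
    using powi_le_exp[OF a, of "k - 2"] by metis
  have weight: "y powi k / y\<^sup>2 = y powi (k - 2)" if "y > 0" for y :: real
    using that by (simp add: power_int_diff)
  show ?thesis
  proof (rule integrable_exponential_decay_strip[where a = a and C = "C\<^sup>2 * C'"])
    have hol: "f holomorphic_on upper_half"
      using cusp by (simp add: cusp_form_def modular_form_def)
    have "continuous_on fund_domain (\<lambda>\<tau>. (norm (f \<tau>))\<^sup>2 * (Im \<tau> powi k / (Im \<tau>)\<^sup>2))"
      by (intro continuous_intros continuous_on_subset[OF holomorphic_on_imp_continuous_on[OF hol]])
         (auto simp: fund_domain_def upper_half_def)
    from borel_measurable_continuous_on_indicator[OF fund_domain_sets this]
    show "(\<lambda>\<tau>. indicator fund_domain \<tau> * ((norm (f \<tau>))\<^sup>2 * (Im \<tau> powi k / (Im \<tau>)\<^sup>2)))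
        \<in> borel_measurable lborel"
      by simp
  next
    fix \<tau>
    show "\<bar>indicator fund_domain \<tau> * ((norm (f \<tau>))\<^sup>2 * (Im \<tau> powi k / (Im \<tau>)\<^sup>2))\<bar>
        \<le> C\<^sup>2 * C' * exp (- a * Im \<tau>)"
    proof (cases "\<tau> \<in> fund_domain")
      case True
      note strip = fund_domain_strip[OF True]
      have "(norm (f \<tau>))\<^sup>2 * Im \<tau> powi (k - 2) \<le> (C * exp (- a * Im \<tau>))\<^sup>2 * (C' * exp (a * Im \<tau>))"
        using strip decay[OF strip] C' C by (intro mult_mono power_mono) auto
      also have "\<dots> = C\<^sup>2 * C' * (exp (- a * Im \<tau>) * exp (- a * Im \<tau>) * exp (a * Im \<tau>))"
        by (simp add: power2_eq_square algebra_simps)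
      also have "exp (- a * Im \<tau>) * exp (- a * Im \<tau>) * exp (a * Im \<tau>) = exp (- a * Im \<tau>)"
        by (simp flip: exp_add)
      finally show ?thesis using True strip by (simp add: weight)
    qed (use C C' in auto)
  next
    fix \<tau>
    assume "indicator fund_domain \<tau> * ((norm (f \<tau>))\<^sup>2 * (Im \<tau> powi k / (Im \<tau>)\<^sup>2)) \<noteq> 0"
    then have "\<tau> \<in> fund_domain" by (auto simp: indicator_def split: if_splits)
    then show "\<bar>Re \<tau>\<bar> \<le> 1 / 2 \<and> Im \<tau> \<ge> 0" using fund_domain_strip[of \<tau>] by simp
  qed (use a C' in simp_all)
qed

text \<open>A nonnegative integrable function with integral 0 vanishes almost everywhere. The set
  where \<open>f x\<close> is nonzero inside the domain is open, hence empty once it is null, and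
  analytic continuation carries the vanishing to the whole upper half plane.\<close>

lemma sum_square_integral_zero_imp_zero:
  assumes "finite X" and cusp: "\<And>x. x \<in> X \<Longrightarrow> \<exists>N>0. cusp_form N k (f x)"
    and zero: "(LINT \<tau>:fund_domain|lborel.
      of_real ((\<Sum>x\<in>X. (norm (f x \<tau>))\<^sup>2) * (Im \<tau> powi k / (Im \<tau>)\<^sup>2))) = (0 :: complex)"
    and "x \<in> X" "\<tau> \<in> upper_half"
  shows "f x \<tau> = 0"
proof -
  define g where "g \<tau> = (\<Sum>x\<in>X. indicator fund_domain \<tau> * ((norm (f x \<tau>))\<^sup>2 * (Im \<tau> powi k / (Im \<tau>)\<^sup>2)))" for \<tau>
  have int: "integrable lborel g"
    unfolding g_def using cusp cusp_form_square_integrable by (intro Bochner_Integration.integrable_sum) blast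
  have g_nonneg: "g \<tau> \<ge> 0" for \<tau>
    unfolding g_def using fund_domain_strip(2)[of \<tau>]
    by (intro sum_nonneg) (auto simp: indicator_def intro!: mult_nonneg_nonneg zero_le_power_int divide_nonneg_nonneg)
  have "complex_of_real (integral\<^sup>L lborel g) = 0"
    unfolding zero[symmetric] integral_complex_of_real[symmetric] set_lebesgue_integral_def g_def
    by (intro Bochner_Integration.integral_cong)
       (auto simp: indicator_def sum_distrib_left sum_distrib_right sum_divide_distrib mult.assoc)
  then have "AE \<tau> in lborel. g \<tau> = 0"
    using integral_nonneg_eq_0_iff_AE[OF int] g_nonneg by simp
  then obtain Z where Z: "Z \<in> null_sets lborel" "{\<tau>. g \<tau> \<noteq> 0} \<subseteq> Z"
    by (elim AE_E3) auto
  have hol: "f x holomorphic_on upper_half"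
    using cusp[OF \<open>x \<in> X\<close>] by (auto simp: cusp_form_def modular_form_def)
  \<comment> \<open>A nonempty open part of \<open>fund_domain\<close>; the point
    \<open>2 * \<i>\<close> in it later serves as the limit point for the identity theorem.\<close>
  define U where "U = {\<tau>. \<bar>Re \<tau>\<bar> < 1 / 2} \<inter> {\<tau>. norm \<tau> > 1} \<inter> upper_half"
  have "open U"
    unfolding U_def by (intro open_Int open_Collect_less continuous_intros upper_half_open)
  define W where "W = {\<tau> \<in> U. f x \<tau> \<noteq> 0}"
  have "open W"
  proof -
    have "continuous_on U (f x)"
      using holomorphic_on_imp_continuous_on[OF hol] by (rule continuous_on_subset) (auto simp: U_def)
    then have "open (U \<inter> f x -` (- {0}))"
      using \<open>open U\<close> by (intro continuous_open_preimage) auto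
    moreover have "W = U \<inter> f x -` (- {0})" by (auto simp: W_def)
    ultimately show ?thesis by simp
  qed
  have "g \<tau> \<noteq> 0" if "\<tau> \<in> W" for \<tau>
  proof -
    have fd: "\<tau> \<in> fund_domain" and pos: "Im \<tau> > 0"
      using that by (auto simp: W_def U_def fund_domain_def upper_half_def)
    have "0 < (norm (f x \<tau>))\<^sup>2 * (Im \<tau> powi k / (Im \<tau>)\<^sup>2)"
      using that pos by (auto simp: W_def intro!: mult_pos_pos divide_pos_pos zero_less_power_int)
    also have "\<dots> \<le> (\<Sum>x\<in>X. (norm (f x \<tau>))\<^sup>2 * (Im \<tau> powi k / (Im \<tau>)\<^sup>2))"
      using pos assms by (intro member_le_sum) (auto intro!: mult_nonneg_nonneg divide_nonneg_nonneg)
    finally show ?thesis using fd by (simp add: g_def)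
  qed
  then have "W \<subseteq> Z" using Z by auto
  then have "negligible W"
    using Z(1) by (auto simp: negligible_iff_null_sets intro: null_sets_completion_subset null_sets_completionI)
  then have "W = {}"
    using \<open>open W\<close> open_not_negligible by blast
  then have zeroU: "f x z = 0" if "z \<in> U" for z
    using that by (auto simp: W_def)
  have "2 * \<i> \<in> U" by (simp add: U_def upper_half_def norm_mult)
  have "connected upper_half"
    unfolding upper_half_def by (intro convex_connected convex_halfspace_Im_gt)
  moreover have "2 * \<i> islimpt U"
    using \<open>open U\<close> \<open>2 * \<i> \<in> U\<close> by (simp add: interior_limit_point interior_open)
  ultimately show ?thesis
    using hol zeroU \<open>2 * \<i> \<in> U\<close> \<open>\<tau> \<in> upper_half\<close>
    by (intro analytic_continuation[of "f x" upper_half U "2 * \<i>" \<tau>]) (auto simp: U_def)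
qed

section \<open>Generators of the modular group\<close>

lemma matrix_2_eqI:
  fixes A B :: "'a ^ 2 ^ 2"
  assumes "A $ 1 $ 1 = B $ 1 $ 1" "A $ 1 $ 2 = B $ 1 $ 2" "A $ 2 $ 1 = B $ 2 $ 1" "A $ 2 $ 2 = B $ 2 $ 2"
  shows "A = B"
  using assms by (simp add: vec_eq_iff forall_2)

lemmas mult_2x2 = matrix_matrix_mult_def sum_2 vector_2 det_2 mat_def

lemma SL2Z_mult: "A \<in> SL2Z \<Longrightarrow> B \<in> SL2Z \<Longrightarrow> A ** B \<in> SL2Z"
  by (simp add: SL2Z_def det_mul)

lemma S_mat_in_SL2Z [simp]: "S_mat \<in> SL2Z" and T_mat_in_SL2Z [simp]: "T_mat \<in> SL2Z"
  by (simp_all add: SL2Z_def S_mat_def T_mat_def det_2 vector_2)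

definition translation_mat :: "int \<Rightarrow> int ^ 2 ^ 2" where
  "translation_mat n = vector [vector [1, n], vector [0, 1]]"

lemma translation_mat_in_SL2Z [simp]: "translation_mat n \<in> SL2Z"
  by (simp add: SL2Z_def translation_mat_def det_2 vector_2)

lemma translation_mat_Suc: "translation_mat (n + 1) = T_mat ** translation_mat n"
  and translation_mat_pred: "translation_mat (n - 1) = translation_mat (- 1) ** translation_mat n"
  and translation_mat_0: "translation_mat 0 = mat 1"
  by (rule matrix_2_eqI; simp add: translation_mat_def T_mat_def mult_2x2)+

text \<open>Euclid's algorithm on the first column.\<close>

lemma SL2Z_induct [consumes 1, case_names one S T T_inv]:
  assumes "M \<in> SL2Z"
    and one: "P (mat 1)"
    and S: "\<And>M. M \<in> SL2Z \<Longrightarrow> P M \<Longrightarrow> P (S_mat ** M)"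
    and T: "\<And>M. M \<in> SL2Z \<Longrightarrow> P M \<Longrightarrow> P (T_mat ** M)"
    and T_inv: "\<And>M. M \<in> SL2Z \<Longrightarrow> P M \<Longrightarrow> P (translation_mat (- 1) ** M)"
  shows "P M"
proof -
  have trans: "P (translation_mat n ** M)" if "M \<in> SL2Z" "P M" for n M
  proof (induction n rule: int_induct[where k = 0])
    case base
    then show ?case using that by (simp add: translation_mat_0)
  next
    case (step1 i)
    then show ?case
      using T[of "translation_mat i ** M"] SL2Z_mult[OF translation_mat_in_SL2Z that(1)]
      by (simp add: translation_mat_Suc matrix_mul_assoc)
  next
    case (step2 i)
    then show ?case
      using T_inv[of "translation_mat i ** M"] SL2Z_mult[OF translation_mat_in_SL2Z that(1)]
      by (simp add: translation_mat_pred[of i] matrix_mul_assoc)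
  qed
  show ?thesis
    using \<open>M \<in> SL2Z\<close>
  proof (induction "nat \<bar>M $ 2 $ 1\<bar>" arbitrary: M rule: less_induct)
    case less
    define a b c d where "a = M $ 1 $ 1" and "b = M $ 1 $ 2" and "c = M $ 2 $ 1" and "d = M $ 2 $ 2"
    note abcd = a_def b_def c_def d_def
    have det: "a * d - b * c = 1"
      using less.prems by (simp add: SL2Z_def det_2 abcd)
    show ?case
    proof (cases "c = 0")
      case True
      then have "a * d = 1" using det by simp
      then consider "a = 1" "d = 1" | "a = - 1" "d = - 1"
        using zmult_eq_1_iff by blast
      then show ?thesis
      proof cases
        case 1
        then have "M = translation_mat b ** mat 1"
          using True by (intro matrix_2_eqI) (simp_all add: translation_mat_def vector_2 abcd)
        then show ?thesis using trans[OF _ one] by simp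
      next
        case 2
        \<comment> \<open>The square of \<open>S_mat\<close> is minus the identity and supplies the
          sign.\<close>
        then have "M = S_mat ** (S_mat ** (translation_mat (- b) ** mat 1))"
          using True by (intro matrix_2_eqI) (simp_all add: translation_mat_def S_mat_def mult_2x2 abcd)
        then show ?thesis
          using S[OF _ S[OF _ trans[OF _ one]], of "- b"] SL2Z_mult by simp
      qed
    next
      case False
      define q where "q = a div c"
      \<comment> \<open>The first column \<open>(a, c)\<close> of \<open>M\<close> becomes
        \<open>(- c, a mod c)\<close>: one division step.\<close>
      define M' where "M' = S_mat ** (translation_mat (- q) ** M)"
      have "M' $ 2 $ 1 = a mod c"
        by (simp add: M'_def S_mat_def translation_mat_def mult_2x2 q_def abcd
              minus_div_mult_eq_mod[symmetric])
      moreover have "\<bar>a mod c\<bar> < \<bar>c\<bar>"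
        using False by (rule abs_mod_less)
      moreover have "M' \<in> SL2Z"
        unfolding M'_def using less.prems by (intro SL2Z_mult) simp_all
      ultimately have "P M'"
        using less.hyps[of M'] by (simp add: c_def)
      \<comment> \<open>\<open>S_mat\<close> has order 4, so three factors undo the one in
        \<open>M'\<close>, and the induction rule can do without a case for its inverse.\<close>
      then have "P (S_mat ** (S_mat ** (S_mat ** M')))"
        using \<open>M' \<in> SL2Z\<close> by (intro S SL2Z_mult) simp_all
      moreover have "S_mat ** (S_mat ** (S_mat ** M')) \<in> SL2Z"
        using \<open>M' \<in> SL2Z\<close> by (intro SL2Z_mult) simp_all
      moreover have "M = translation_mat q ** (S_mat ** (S_mat ** (S_mat ** M')))"
        by (intro matrix_2_eqI) (simp_all add: M'_def translation_mat_def S_mat_def mult_2x2)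
      ultimately show ?thesis using trans by metis
    qed
  qed
qed

section \<open>Isotropic subgroups of discriminant forms\<close>

lemma e_qmodz_add: "e_qmodz (x + y) = e_qmodz x * e_qmodz y"
  by transfer (simp add: ee_def of_rat_add distrib_left exp_add)

lemma e_qmodz_0 [simp]: "e_qmodz 0 = 1"
  by transfer (simp add: ee_def)

lemma e_qmodz_eq_1_iff [simp]: "e_qmodz x = 1 \<longleftrightarrow> x = 0"
proof (transfer)
  fix x :: rat
  show "ee (real_of_rat x) = 1 \<longleftrightarrow> x - 0 \<in> \<int>"
  proof
    assume "ee (real_of_rat x) = 1"
    then obtain n :: int where "2 * pi * real_of_rat x = of_int (2 * n) * pi"
      by (auto simp: ee_def exp_eq_1)
    then have "real_of_rat x = real_of_rat (of_int n)" by simp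
    then show "x - 0 \<in> \<int>" unfolding of_rat_eq_iff by simp
  next
    assume "x - 0 \<in> \<int>"
    then obtain n :: int where "x = of_int n" by (auto elim: Ints_cases)
    then show "ee (real_of_rat x) = 1"
      using ee_of_int_add[of 0 n] by (simp add: ee_def)
  qed
qed

lemma (in group) sum_subgroup_translate:
  assumes "subgroup H G" "a \<in> H"
  shows "(\<Sum>x\<in>H. f (x \<otimes> a)) = (\<Sum>x\<in>H. f x)"
proof (rule sum.reindex_bij_betw)
  have "a \<in> carrier G" "\<And>x. x \<in> H \<Longrightarrow> x \<in> carrier G" using assms subgroup.subset by blast+
  then show "bij_betw (\<lambda>x. x \<otimes> a) H H"
    using assms by (intro bij_betwI[where g = "\<lambda>x. x \<otimes> inv a"])
      (auto simp: m_assoc subgroup.m_closed subgroup.m_inv_closed)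
qed

text \<open>Translating the summation by \<open>a\<close> multiplies the sum by
  \<open>\<psi> a\<close>, which differs from 1.\<close>

lemma (in group) sum_character_eq_0:
  fixes \<psi> :: "'a \<Rightarrow> 'c :: idom"
  assumes "subgroup H G" "\<And>x y. x \<in> H \<Longrightarrow> y \<in> H \<Longrightarrow> \<psi> (x \<otimes> y) = \<psi> x * \<psi> y"
    and "a \<in> H" "\<psi> a \<noteq> 1"
  shows "(\<Sum>x\<in>H. \<psi> x) = 0"
proof -
  have "(\<Sum>x\<in>H. \<psi> x) = (\<Sum>x\<in>H. \<psi> (x \<otimes> a))"
    using sum_subgroup_translate[OF assms(1,3), of \<psi>] by simp
  also have "\<dots> = (\<Sum>x\<in>H. \<psi> x) * \<psi> a"
    using assms by (simp add: sum_distrib_right)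
  finally have "(\<Sum>x\<in>H. \<psi> x) * (\<psi> a - 1) = 0" by (simp add: algebra_simps)
  then show ?thesis using assms by simp
qed

context discriminant_form
begin

lemma bform_commute: "\<gamma> \<in> carrier D \<Longrightarrow> \<delta> \<in> carrier D \<Longrightarrow> bform D Q \<gamma> \<delta> = bform D Q \<delta> \<gamma>"
  by (simp add: bform_def m_comm)

lemma bform_mult_right:
  "\<gamma> \<in> carrier D \<Longrightarrow> \<delta> \<in> carrier D \<Longrightarrow> \<delta>' \<in> carrier D \<Longrightarrow>
   bform D Q \<gamma> (\<delta> \<otimes> \<delta>') = bform D Q \<gamma> \<delta> + bform D Q \<gamma> \<delta>'"
  using bform_mult[of \<delta> \<delta>' \<gamma>] by (simp add: bform_commute)

lemma Q_one [simp]: "Q \<one> = 0"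
proof -
  have "int_mult 0 (Q \<one>) = 0" by transfer simp
  then show ?thesis using Q_int_pow[of \<one> 0] by simp
qed

lemma Q_mult: "Q (\<gamma> \<otimes> \<delta>) = Q \<gamma> + Q \<delta> + bform D Q \<gamma> \<delta>"
  by (simp add: bform_def)

lemma bform_one_left [simp]: "\<delta> \<in> carrier D \<Longrightarrow> bform D Q \<one> \<delta> = 0"
  by (simp add: bform_def)

lemma bform_inv_left: "\<gamma> \<in> carrier D \<Longrightarrow> \<delta> \<in> carrier D \<Longrightarrow> bform D Q (inv \<gamma>) \<delta> = - bform D Q \<gamma> \<delta>"
  using bform_mult[of \<gamma> "inv \<gamma>" \<delta>] by (simp add: eq_neg_iff_add_eq_0 add.commute)

lemma perp_subgroup: "H \<subseteq> carrier D \<Longrightarrow> subgroup (perp D Q H) D"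
  by (rule subgroupI) (auto simp: perp_def bform_inv_left bform_mult subset_iff)

lemma sum_bform_character:
  assumes "subgroup K D" "\<gamma> \<in> carrier D"
  shows "(\<Sum>x\<in>K. e_qmodz (bform D Q \<gamma> x)) = (if \<forall>x\<in>K. bform D Q \<gamma> x = 0 then of_nat (card K) else 0)"
proof (cases "\<forall>x\<in>K. bform D Q \<gamma> x = 0")
  case False
  then obtain a where "a \<in> K" "bform D Q \<gamma> a \<noteq> 0" by blast
  then have "(\<Sum>x\<in>K. e_qmodz (bform D Q \<gamma> x)) = 0"
    using assms subgroup.subset[OF assms(1)]
    by (intro sum_character_eq_0[of K _ a]) (auto simp: bform_mult_right e_qmodz_add subset_iff)
  with False show ?thesis by auto
qed simp

end

locale isotropic_subgroup = discriminant_form +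
  fixes H :: "'a set"
  assumes isotropic: "isotropic D Q H"
begin

abbreviation "D\<^sub>H \<equiv> quot_group D Q H"
abbreviation "H\<^sub>p \<equiv> perp D Q H"

lemma subgroup_H: "subgroup H D"
  using isotropic by (simp add: isotropic_def)

lemma H_carrier: "h \<in> H \<Longrightarrow> h \<in> carrier D"
  using subgroup.subset[OF subgroup_H] by blast

lemma Q_H [simp]: "h \<in> H \<Longrightarrow> Q h = 0"
  using isotropic by (simp add: isotropic_def)

lemma finite_H [simp]: "finite H"
  using finite_carrier subgroup.subset[OF subgroup_H] finite_subset by blast

lemma H_nonempty [simp]: "H \<noteq> {}"
  using subgroup.one_closed[OF subgroup_H] by blast

lemma perp_carrier: "\<gamma> \<in> H\<^sub>p \<Longrightarrow> \<gamma> \<in> carrier D"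
  by (simp add: perp_def)

lemma subgroup_perp: "subgroup H\<^sub>p D"
  using perp_subgroup subgroup.subset[OF subgroup_H] by blast

lemma finite_perp [simp]: "finite H\<^sub>p"
  using finite_carrier by (rule finite_subset[rotated]) (auto simp: perp_def)

lemma bform_perp: "\<gamma> \<in> H\<^sub>p \<Longrightarrow> h \<in> H \<Longrightarrow> bform D Q \<gamma> h = 0"
  by (simp add: perp_def)

lemma H_subset_perp: "h \<in> H \<Longrightarrow> h \<in> H\<^sub>p"
  using subgroup.m_closed[OF subgroup_H] by (auto simp: perp_def bform_def H_carrier)

lemma perp_mult: "\<gamma> \<in> H\<^sub>p \<Longrightarrow> \<delta> \<in> H\<^sub>p \<Longrightarrow> \<gamma> \<otimes> \<delta> \<in> H\<^sub>p"
  by (rule subgroup.m_closed[OF subgroup_perp])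

lemma perp_mult_H_iff: "\<gamma> \<in> carrier D \<Longrightarrow> h \<in> H \<Longrightarrow> \<gamma> \<otimes> h \<in> H\<^sub>p \<longleftrightarrow> \<gamma> \<in> H\<^sub>p"
  using bform_perp[OF H_subset_perp] by (auto simp: perp_def bform_mult H_carrier)

lemma Q_mult_H: "\<gamma> \<in> H\<^sub>p \<Longrightarrow> h \<in> H \<Longrightarrow> Q (\<gamma> \<otimes> h) = Q \<gamma>"
  by (simp add: Q_mult bform_perp)

lemma coset_eq_image: "\<gamma> \<in> carrier D \<Longrightarrow> H #> \<gamma> = (\<lambda>h. \<gamma> \<otimes> h) ` H"
  by (auto simp: r_coset_def m_comm H_carrier image_iff)

lemma mem_coset_self: "\<gamma> \<in> carrier D \<Longrightarrow> \<gamma> \<in> H #> \<gamma>"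
  using rcos_self subgroup_H by blast

lemma coset_eqI: "\<gamma> \<in> carrier D \<Longrightarrow> \<delta> \<in> H #> \<gamma> \<Longrightarrow> H #> \<delta> = H #> \<gamma>"
  using repr_independence[OF _ _ subgroup_H] by metis

lemma coset_mult_H [simp]: "\<gamma> \<in> carrier D \<Longrightarrow> h \<in> H \<Longrightarrow> H #> (\<gamma> \<otimes> h) = H #> \<gamma>"
  by (rule coset_eqI) (auto simp: coset_eq_image)

lemma sum_coset:
  assumes "\<gamma> \<in> carrier D"
  shows "(\<Sum>x\<in>H #> \<gamma>. f x) = (\<Sum>h\<in>H. f (\<gamma> \<otimes> h))"
  unfolding coset_eq_image[OF assms]
  by (rule sum.reindex_cong[OF _ refl refl]) (use assms H_carrier in \<open>auto intro!: inj_onI\<close>)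

lemma carrier_quot: "carrier D\<^sub>H = (\<lambda>\<gamma>. H #> \<gamma>) ` H\<^sub>p"
  by (auto simp: quot_group_def FactGroup_def RCOSETS_def r_coset_def)

lemma coset_in_quot [simp]: "\<gamma> \<in> H\<^sub>p \<Longrightarrow> H #> \<gamma> \<in> carrier D\<^sub>H"
  by (simp add: carrier_quot)

lemma quotE:
  assumes "\<alpha> \<in> carrier D\<^sub>H" obtains \<gamma> where "\<gamma> \<in> H\<^sub>p" "\<alpha> = H #> \<gamma>"
  using assms by (auto simp: carrier_quot)

lemma finite_quot [simp]: "finite (carrier D\<^sub>H)"
  by (simp add: carrier_quot)

lemma coset_subset_perp: "\<gamma> \<in> H\<^sub>p \<Longrightarrow> H #> \<gamma> \<subseteq> H\<^sub>p"
  by (auto simp: coset_eq_image perp_carrier perp_mult_H_iff)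

lemma mem_quot_iff: "\<alpha> \<in> carrier D\<^sub>H \<Longrightarrow> \<gamma> \<in> \<alpha> \<longleftrightarrow> \<gamma> \<in> H\<^sub>p \<and> H #> \<gamma> = \<alpha>"
  by (elim quotE) (metis coset_subset_perp coset_eqI mem_coset_self perp_carrier subsetD)

lemma sum_perp: "(\<Sum>\<gamma>\<in>H\<^sub>p. f \<gamma>) = (\<Sum>\<alpha>\<in>carrier D\<^sub>H. \<Sum>\<gamma>\<in>\<alpha>. f \<gamma>)"
proof -
  have "(\<Sum>\<alpha>\<in>carrier D\<^sub>H. \<Sum>\<gamma>\<in>\<alpha>. f \<gamma>) = (\<Sum>\<alpha>\<in>carrier D\<^sub>H. sum f {\<gamma> \<in> H\<^sub>p. H #> \<gamma> = \<alpha>})"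
    by (intro sum.cong refl) (auto simp: mem_quot_iff)
  also have "\<dots> = (\<Sum>\<gamma>\<in>H\<^sub>p. f \<gamma>)"
    by (intro sum.group) auto
  finally show ?thesis by simp
qed

lemma sum_perp_coset:
  fixes f :: "'a set \<Rightarrow> 'c :: comm_semiring_1"
  shows "(\<Sum>\<gamma>\<in>H\<^sub>p. f (H #> \<gamma>)) = of_nat (card H) * (\<Sum>\<alpha>\<in>carrier D\<^sub>H. f \<alpha>)"
  unfolding sum_perp sum_distrib_left
  by (intro sum.cong refl) (auto elim!: quotE simp: sum_coset perp_carrier)

lemma quot_form_coset [simp]: "\<gamma> \<in> H\<^sub>p \<Longrightarrow> quot_form Q (H #> \<gamma>) = Q \<gamma>"
proof -
  assume \<gamma>: "\<gamma> \<in> H\<^sub>p"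
  have "Q ` (H #> \<gamma>) = {Q \<gamma>}"
    using \<gamma> Q_mult_H mem_coset_self[of \<gamma>] by (auto simp: coset_eq_image perp_carrier)
  then show ?thesis by (simp add: quot_form_def)
qed

lemma quot_mult:
  assumes "\<gamma> \<in> H\<^sub>p" "\<delta> \<in> H\<^sub>p"
  shows "(H #> \<gamma>) \<otimes>\<^bsub>D\<^sub>H\<^esub> (H #> \<delta>) = H #> (\<gamma> \<otimes> \<delta>)"
proof -
  have "(H #> \<gamma>) \<otimes>\<^bsub>D\<^sub>H\<^esub> (H #> \<delta>) = (H #> \<gamma>) <#> (H #> \<delta>)"
    by (simp add: quot_group_def FactGroup_def set_mult_def)
  then show ?thesis
    using normal.rcos_sum[OF subgroup_imp_normal[OF subgroup_H]] assms perp_carrier by simp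
qed

lemma quot_bform [simp]:
  "\<gamma> \<in> H\<^sub>p \<Longrightarrow> \<delta> \<in> H\<^sub>p \<Longrightarrow> bform D\<^sub>H (quot_form Q) (H #> \<gamma>) (H #> \<delta>) = bform D Q \<gamma> \<delta>"
  by (simp add: bform_def quot_mult perp_mult)

lemma sum_bform_H:
  "\<gamma> \<in> carrier D \<Longrightarrow> (\<Sum>h\<in>H. e_qmodz (bform D Q \<gamma> h)) = (if \<gamma> \<in> H\<^sub>p then of_nat (card H) else 0)"
  using sum_bform_character[OF subgroup_H] by (simp add: perp_def)

lemma card_perp: "card H\<^sub>p = card H * card (carrier D\<^sub>H)"
  using sum_perp_coset[of "\<lambda>_. 1 :: nat"] by simp

text \<open>Double count of the sum of \<open>e_qmodz (bform D Q \<gamma> h)\<close> over all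
  \<open>\<gamma>\<close> and \<open>h\<close>: summing over \<open>h\<close> first leaves
  \<open>card H\<close> for each element of the orthogonal complement, summing over
  \<open>\<gamma>\<close> first leaves only \<open>h = \<one>\<close>, by nondegeneracy.\<close>

lemma card_carrier_perp: "card (carrier D) = card H * card H\<^sub>p"
proof -
  have "of_nat (card H * card H\<^sub>p) = (\<Sum>\<gamma>\<in>carrier D. if \<gamma> \<in> H\<^sub>p then of_nat (card H) else (0 :: complex))"
    using finite_carrier by (simp add: sum.If_cases perp_carrier Int_absorb1 subset_iff Int_def
        flip: perp_def) (auto intro!: arg_cong[of _ _ card] simp: perp_carrier)
  also have "\<dots> = (\<Sum>\<gamma>\<in>carrier D. \<Sum>h\<in>H. e_qmodz (bform D Q \<gamma> h))"
    by (simp add: sum_bform_H)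
  also have "\<dots> = (\<Sum>h\<in>H. \<Sum>\<gamma>\<in>carrier D. e_qmodz (bform D Q h \<gamma>))"
    by (subst sum.swap) (auto intro!: sum.cong simp: bform_commute H_carrier)
  also have "\<dots> = (\<Sum>h\<in>H. if h = \<one> then of_nat (card (carrier D)) else 0)"
    using nondegenerate by (intro sum.cong refl)
      (auto simp: sum_bform_character[OF subgroup_self] H_carrier)
  also have "\<dots> = of_nat (card (carrier D))"
    using subgroup.one_closed[OF subgroup_H] by simp
  finally show ?thesis by (metis of_nat_eq_iff)
qed

lemma sqrt_card_carrier: "sqrt (card (carrier D)) = card H * sqrt (card (carrier D\<^sub>H))"
  by (simp add: card_carrier_perp card_perp real_sqrt_mult flip: mult.assoc)

text \<open>Average over translates by \<open>H\<close>: since \<open>Q\<close> vanishes on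
  \<open>H\<close>, translation by \<open>h\<close> multiplies the term at \<open>\<gamma>\<close>
  by \<open>e_qmodz (bform D Q \<gamma> h)\<close>, and summing over \<open>h\<close> kills every
  \<open>\<gamma>\<close> outside \<open>H\<^sub>p\<close>. What survives is constant on
  cosets.\<close>

lemma gauss_sum_quot:
  "(\<Sum>\<gamma>\<in>carrier D. e_qmodz (Q \<gamma>)) = of_nat (card H) * (\<Sum>\<alpha>\<in>carrier D\<^sub>H. e_qmodz (quot_form Q \<alpha>))"
proof -
  have "of_nat (card H) * (\<Sum>\<gamma>\<in>carrier D. e_qmodz (Q \<gamma>)) = (\<Sum>h\<in>H. \<Sum>\<gamma>\<in>carrier D. e_qmodz (Q (\<gamma> \<otimes> h)))"
    by (simp add: sum_subgroup_translate[OF subgroup_self H_carrier, of _ "\<lambda>\<gamma>. e_qmodz (Q \<gamma>)"])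
  also have "\<dots> = (\<Sum>\<gamma>\<in>carrier D. \<Sum>h\<in>H. e_qmodz (Q \<gamma>) * e_qmodz (bform D Q \<gamma> h))"
    by (subst sum.swap) (simp add: Q_mult e_qmodz_add)
  also have "\<dots> = (\<Sum>\<gamma>\<in>carrier D. if \<gamma> \<in> H\<^sub>p then of_nat (card H) * e_qmodz (Q \<gamma>) else 0)"
    by (intro sum.cong refl) (auto simp: sum_bform_H simp flip: sum_distrib_left)
  also have "\<dots> = (\<Sum>\<gamma>\<in>H\<^sub>p. of_nat (card H) * e_qmodz (Q \<gamma>))"
    using finite_carrier perp_carrier by (intro sum.mono_neutral_cong_right) auto
  also have "\<dots> = of_nat (card H) * (\<Sum>\<gamma>\<in>H\<^sub>p. e_qmodz (quot_form Q (H #> \<gamma>)))"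
    by (simp add: sum_distrib_left)
  finally show ?thesis
    unfolding sum_perp_coset[of "\<lambda>\<alpha>. e_qmodz (quot_form Q \<alpha>)"] by simp
qed

lemma has_signature_quot: "has_signature D\<^sub>H (quot_form Q) t \<longleftrightarrow> has_signature D Q t"
  by (simp add: has_signature_def gauss_sum_quot sqrt_card_carrier mult.assoc)

text \<open>The two defining predicates agree at every integer, hence so do the definite
  descriptions.\<close>

lemma signature_quot: "signature D\<^sub>H (quot_form Q) = signature D Q"
  by (simp add: signature_def has_signature_quot)

section \<open>The arrow maps in coordinates\<close>

lemma up_apply: "up D Q H w \<gamma> = (if \<gamma> \<in> H\<^sub>p then w (H #> \<gamma>) else 0)"
proof -
  have "up D Q H w \<gamma> = (\<Sum>\<alpha>\<in>carrier D\<^sub>H. if \<gamma> \<in> \<alpha> then w \<alpha> else 0)"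
  proof -
    have "finite \<alpha>" if "\<alpha> \<in> carrier D\<^sub>H" for \<alpha>
      using that coset_subset_perp finite_subset[OF _ finite_perp] by (auto elim!: quotE)
    then show ?thesis
      unfolding up_def lin_ext_def by (intro sum.cong refl) (simp add: basis_vec_def)
  qed
  also have "\<dots> = (\<Sum>\<alpha>\<in>carrier D\<^sub>H. if \<alpha> = H #> \<gamma> then (if \<gamma> \<in> H\<^sub>p then w (H #> \<gamma>) else 0) else 0)"
    by (intro sum.cong refl) (auto simp: mem_quot_iff)
  also have "\<dots> = (if \<gamma> \<in> H\<^sub>p then w (H #> \<gamma>) else 0)"
    by simp
  finally show ?thesis .
qed

text \<open>Holds for an arbitrary set \<open>\<alpha>\<close>: if it is not a coset in
  \<open>H\<^sub>p\<close>, the index set is empty. This is what places the image of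
  \<open>down\<close> in the group algebra of the quotient.\<close>

lemma down_eq_sum: "down D Q H v \<alpha> = (\<Sum>\<gamma>\<in>{\<gamma> \<in> H\<^sub>p. H #> \<gamma> = \<alpha>}. v \<gamma>)"
proof -
  have "down D Q H v \<alpha> = (\<Sum>\<gamma>\<in>carrier D. if \<gamma> \<in> {\<gamma> \<in> H\<^sub>p. H #> \<gamma> = \<alpha>} then v \<gamma> else 0)"
    unfolding down_def lin_ext_def by (intro sum.cong refl) (auto simp: basis_vec_def)
  also have "\<dots> = (\<Sum>\<gamma>\<in>{\<gamma> \<in> H\<^sub>p. H #> \<gamma> = \<alpha>}. v \<gamma>)"
    using finite_carrier perp_carrier by (intro sum.mono_neutral_cong_right) auto
  finally show ?thesis .
qed

lemma down_quot: "\<alpha> \<in> carrier D\<^sub>H \<Longrightarrow> down D Q H v \<alpha> = (\<Sum>\<gamma>\<in>\<alpha>. v \<gamma>)"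
  unfolding down_eq_sum by (rule sum.cong) (auto simp: mem_quot_iff)

lemma down_coset: "\<gamma> \<in> H\<^sub>p \<Longrightarrow> down D Q H v (H #> \<gamma>) = (\<Sum>h\<in>H. v (\<gamma> \<otimes> h))"
  by (simp add: down_quot sum_coset perp_carrier)

lemma down_in_group_alg: "down D Q H v \<in> group_alg D\<^sub>H"
  unfolding group_alg_def down_eq_sum by (auto intro!: sum.neutral)

lemma up_in_group_alg: "up D Q H w \<in> group_alg D"
  by (auto simp: group_alg_def up_apply perp_carrier)

text \<open>Both sides are the sum of \<open>w (H #> \<gamma>) * v \<gamma>\<close> over
  \<open>H\<^sub>p\<close>, on the right grouped by cosets. The pairing is bilinear, to match
  \<open>eval_map\<close>.\<close>

lemma up_down_adjoint:
  "(\<Sum>\<gamma>\<in>carrier D. up D Q H w \<gamma> * v \<gamma>) = (\<Sum>\<alpha>\<in>carrier D\<^sub>H. w \<alpha> * down D Q H v \<alpha>)"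
proof -
  have "(\<Sum>\<gamma>\<in>carrier D. up D Q H w \<gamma> * v \<gamma>) = (\<Sum>\<gamma>\<in>H\<^sub>p. w (H #> \<gamma>) * v \<gamma>)"
    using finite_carrier perp_carrier by (intro sum.mono_neutral_cong_right) (auto simp: up_apply)
  also have "\<dots> = (\<Sum>\<alpha>\<in>carrier D\<^sub>H. w \<alpha> * down D Q H v \<alpha>)"
    unfolding sum_perp by (intro sum.cong refl) (auto simp: down_quot sum_distrib_left mem_quot_iff)
  finally show ?thesis .
qed

text \<open>Each coset has \<open>card H\<close> elements. Hence \<open>up\<close> is injective, and
  a structure on its image can be transported back by \<open>down\<close>.\<close>

lemma down_up:
  assumes "w \<in> group_alg D\<^sub>H"
  shows "down D Q H (up D Q H w) = (\<lambda>\<alpha>. of_nat (card H) * w \<alpha>)"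
proof
  fix \<alpha>
  show "down D Q H (up D Q H w) \<alpha> = of_nat (card H) * w \<alpha>"
  proof (cases "\<alpha> \<in> carrier D\<^sub>H")
    case True
    then show ?thesis
      by (auto elim!: quotE simp: down_coset up_apply perp_mult_H_iff perp_carrier)
  next
    case False
    then show ?thesis
      using assms down_in_group_alg[of "up D Q H w"] by (simp add: group_alg_def)
  qed
qed

lemma up_down_apply:
  "up D Q H (down D Q H v) \<gamma> = (if \<gamma> \<in> H\<^sub>p then \<Sum>h\<in>H. v (\<gamma> \<otimes> h) else 0)"
  by (simp add: up_apply down_coset)

lemma up_func_eq_up: "up_func D Q H G \<tau> = up D Q H (G \<tau>)"
proof
  fix \<delta>
  have "up_func D Q H G \<tau> \<delta> = (\<Sum>\<gamma>\<in>H\<^sub>p. if \<gamma> = \<delta> then G \<tau> (H #> \<gamma>) else 0)"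
    unfolding up_func_def by (intro sum.cong refl) (auto simp: basis_vec_def)
  then show "up_func D Q H G \<tau> \<delta> = up D Q H (G \<tau>) \<delta>"
    by (simp add: up_apply)
qed

end

section \<open>Intertwining the Weil representations\<close>

lemma modular_form_imp_bounded: "modular_form N k f \<Longrightarrow> bounded_at_infinity f"
proof -
  assume "modular_form N k f"
  then have "bounded_at_infinity (slash k f (mat 1))"
    using mat_1_in_SL2Z unfolding modular_form_def by blast
  then show ?thesis by (simp add: slash_one[abs_def])
qed

lemma bounded_at_infinity_lincomb:
  assumes "bounded_at_infinity f" "bounded_at_infinity g"
  shows "bounded_at_infinity (\<lambda>\<tau>. a * f \<tau> + g \<tau>)"
proof -
  obtain B C B' C' where *: "\<And>\<tau>. \<tau> \<in> upper_half \<Longrightarrow> Im \<tau> \<ge> B \<Longrightarrow> norm (f \<tau>) \<le> C"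
    "\<And>\<tau>. \<tau> \<in> upper_half \<Longrightarrow> Im \<tau> \<ge> B' \<Longrightarrow> norm (g \<tau>) \<le> C'"
    using assms unfolding bounded_at_infinity_def by blast
  have "norm (a * f \<tau> + g \<tau>) \<le> norm a * C + C'" if "\<tau> \<in> upper_half" "Im \<tau> \<ge> max B B'" for \<tau>
    using that * by (intro norm_triangle_mono) (auto simp: norm_mult intro: mult_left_mono)
  then show ?thesis unfolding bounded_at_infinity_def by blast
qed

lemma vanishes_at_infinity_lincomb:
  assumes "vanishes_at_infinity f" "vanishes_at_infinity g"
  shows "vanishes_at_infinity (\<lambda>\<tau>. a * f \<tau> + g \<tau>)"
  using assms unfolding vanishes_at_infinity_def
  by (intro tendsto_add_zero tendsto_mult_right_zero)

lemma slash_lincomb: "slash k (\<lambda>\<tau>. a * f \<tau> + g \<tau>) M = (\<lambda>\<tau>. a * slash k f M \<tau> + slash k g M \<tau>)"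
  by (simp add: slash_def fun_eq_iff algebra_simps)

lemma Gamma_N_mult_subset: "Gamma_N (N * N') \<subseteq> Gamma_N N"
  by (auto simp: Gamma_N_def intro: dvd_mult_left)

text \<open>The product of the levels is a common level, while the conditions at the cusps range
  over all of \<open>SL2Z\<close> and do not mention the level.\<close>

lemma cusp_form_lincomb:
  assumes "cusp_form N k f" "cusp_form N' k g"
  shows "cusp_form (N * N') k (\<lambda>\<tau>. a * f \<tau> + g \<tau>)"
proof -
  have "Gamma_N (N * N') \<subseteq> Gamma_N N" "Gamma_N (N * N') \<subseteq> Gamma_N N'"
    using Gamma_N_mult_subset[of N N'] Gamma_N_mult_subset[of N' N] by (simp_all add: mult.commute)
  then have "slash k f M \<tau> = f \<tau> \<and> slash k g M \<tau> = g \<tau>"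
    if "M \<in> Gamma_N (N * N')" "\<tau> \<in> upper_half" for M \<tau>
    using assms that unfolding cusp_form_def modular_form_def by blast
  then show ?thesis
    using assms unfolding cusp_form_def modular_form_def slash_lincomb
    by (auto intro!: holomorphic_intros bounded_at_infinity_lincomb vanishes_at_infinity_lincomb)
qed

lemma cusp_form_zero: "cusp_form N k (\<lambda>\<tau>. 0)"
  by (auto simp: cusp_form_def modular_form_def slash_def[abs_def] bounded_at_infinity_def
        vanishes_at_infinity_def)

lemma cusp_form_sum:
  assumes "finite J" "\<And>j. j \<in> J \<Longrightarrow> \<exists>N>0. cusp_form N k (f j)"
  shows "\<exists>N>0. cusp_form N k (\<lambda>\<tau>. \<Sum>j\<in>J. c j * f j \<tau>)"
  using assms
proof (induction J rule: finite_induct)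
  case empty
  then show ?case using cusp_form_zero[of 1 k] by auto
next
  case (insert j J)
  then obtain N N' where "N > 0" "cusp_form N k (f j)" "N' > 0" "cusp_form N' k (\<lambda>\<tau>. \<Sum>j\<in>J. c j * f j \<tau>)"
    by blast
  then show ?case
    using cusp_form_lincomb[of N k "f j" N' _ "c j"] insert.hyps by (intro exI[of _ "N * N'"]) simp
qed

section \<open>Linear maps on the group algebra\<close>

lemma group_alg_basis_vec: "\<gamma> \<in> carrier D \<Longrightarrow> basis_vec \<gamma> \<in> group_alg D"
  by (auto simp: group_alg_def basis_vec_def)

lemma group_alg_expand:
  assumes "finite (carrier D)" "v \<in> group_alg D"
  shows "v = (\<lambda>\<delta>. \<Sum>\<gamma>\<in>carrier D. v \<gamma> * basis_vec \<gamma> \<delta>)"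
  using assms by (auto simp: fun_eq_iff group_alg_def basis_vec_def if_distrib cong: if_cong)

text \<open>Linearity is asked for on \<open>group_alg D\<close> only, since
  \<open>weil_representation\<close> leaves \<rho> unspecified on functions that do not vanish off
  the carrier.\<close>

definition alg_linear :: "('a, 'b) monoid_scheme \<Rightarrow> (('a \<Rightarrow> complex) \<Rightarrow> 'c \<Rightarrow> complex) \<Rightarrow> bool" where
  "alg_linear D L \<longleftrightarrow> (\<forall>v\<in>group_alg D. \<forall>w\<in>group_alg D. \<forall>a b.
     L (\<lambda>\<gamma>. a * v \<gamma> + b * w \<gamma>) = (\<lambda>x. a * L v x + b * L w x))"

lemma alg_linear_lincomb:
  assumes "alg_linear D L" "v \<in> group_alg D" "w \<in> group_alg D"
  shows "L (\<lambda>\<gamma>. a * v \<gamma> + b * w \<gamma>) = (\<lambda>x. a * L v x + b * L w x)"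
  using assms unfolding alg_linear_def by blast

lemma alg_linear_scale:
  assumes "alg_linear D L" "v \<in> group_alg D"
  shows "L (\<lambda>\<gamma>. a * v \<gamma>) = (\<lambda>x. a * L v x)"
  using alg_linear_lincomb[OF assms assms(2), of a 0] by simp

lemma group_alg_sum:
  "(\<And>j. j \<in> J \<Longrightarrow> v j \<in> group_alg D) \<Longrightarrow> (\<lambda>\<gamma>. \<Sum>j\<in>J. c j * v j \<gamma>) \<in> group_alg D"
  by (auto simp: group_alg_def intro!: sum.neutral)

lemma alg_linear_sum:
  assumes "alg_linear D L" "finite J" "\<And>j. j \<in> J \<Longrightarrow> v j \<in> group_alg D"
  shows "L (\<lambda>\<gamma>. \<Sum>j\<in>J. c j * v j \<gamma>) = (\<lambda>x. \<Sum>j\<in>J. c j * L (v j) x)"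
  using assms(2,3)
proof (induction J rule: finite_induct)
  case empty
  have "(\<lambda>\<gamma>. 0) \<in> group_alg D" by (simp add: group_alg_def)
  then show ?case
    using alg_linear_scale[OF assms(1), of "\<lambda>\<gamma>. 0" 0] by simp
next
  case (insert j J)
  then show ?case
    using alg_linear_lincomb[OF assms(1), of "v j" "\<lambda>\<gamma>. \<Sum>j\<in>J. c j * v j \<gamma>" "c j" 1] group_alg_sum[of J v D c]
    by simp
qed

lemma alg_linear_expand:
  assumes "alg_linear D L" "finite (carrier D)" "v \<in> group_alg D"
  shows "L v x = (\<Sum>\<gamma>\<in>carrier D. v \<gamma> * L (basis_vec \<gamma>) x)"
proof -
  have "L v x = L (\<lambda>\<delta>. \<Sum>\<gamma>\<in>carrier D. v \<gamma> * basis_vec \<gamma> \<delta>) x"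
    using group_alg_expand[OF assms(2,3)] by simp
  then show ?thesis
    using alg_linear_sum[OF assms(1,2), of basis_vec v] by (simp add: group_alg_basis_vec)
qed

lemma alg_linear_lin_ext: "alg_linear D (lin_ext E f)"
  by (auto simp: alg_linear_def lin_ext_def fun_eq_iff sum.distrib sum_distrib_left algebra_simps)

lemma alg_linear_compose:
  assumes "alg_linear D L" "alg_linear E K" "\<And>v. v \<in> group_alg D \<Longrightarrow> L v \<in> group_alg E"
  shows "alg_linear D (\<lambda>v. K (L v))"
  using assms by (simp add: alg_linear_def)

lemma alg_linear_sum_ops:
  assumes "\<And>i. i \<in> I \<Longrightarrow> alg_linear D (L i)"
  shows "alg_linear D (\<lambda>v x. \<Sum>i\<in>I. c i * L i v x)"
  using assms by (simp add: alg_linear_def sum.distrib sum_distrib_left algebra_simps)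

lemma alg_linear_down: "alg_linear D (down E Q H)"
  unfolding down_def by (rule alg_linear_lin_ext)

lemma alg_linear_up: "alg_linear D (up E Q H)"
  unfolding up_def by (rule alg_linear_lin_ext)

section \<open>The Weil representation through its generators\<close>

context
  fixes D :: "('a, 'b) monoid_scheme" and Q :: "'a \<Rightarrow> qmodz" and \<rho>
  assumes weil: "weil_representation D Q \<rho>"
begin

lemma weil_closed: "M \<in> SL2Z \<Longrightarrow> v \<in> group_alg D \<Longrightarrow> \<rho> M v \<in> group_alg D"
  and weil_one: "v \<in> group_alg D \<Longrightarrow> \<rho> (mat 1) v = v"
  and weil_mult: "M \<in> SL2Z \<Longrightarrow> M' \<in> SL2Z \<Longrightarrow> v \<in> group_alg D \<Longrightarrow> \<rho> (M ** M') v = \<rho> M (\<rho> M' v)"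
  using weil unfolding weil_representation_def by blast+

lemma weil_alg_linear: "M \<in> SL2Z \<Longrightarrow> alg_linear D (\<rho> M)"
  using weil unfolding weil_representation_def alg_linear_def by blast

lemma weil_T:
  assumes "finite (carrier D)" "v \<in> group_alg D"
  shows "\<rho> T_mat v = (\<lambda>\<gamma>. e_qmodz (Q \<gamma>) * v \<gamma>)"
proof
  fix \<delta>
  have "\<rho> T_mat v \<delta> = (\<Sum>\<gamma>\<in>carrier D. v \<gamma> * (e_qmodz (Q \<gamma>) * basis_vec \<gamma> \<delta>))"
    using alg_linear_expand[OF weil_alg_linear[OF T_mat_in_SL2Z] assms, of \<delta>] weil
    by (simp add: weil_representation_def)
  also have "\<dots> = (\<Sum>\<gamma>\<in>carrier D. if \<gamma> = \<delta> then e_qmodz (Q \<delta>) * v \<delta> else 0)"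
    by (intro sum.cong refl) (auto simp: basis_vec_def)
  also have "\<dots> = e_qmodz (Q \<delta>) * v \<delta>"
    using assms by (auto simp: group_alg_def)
  finally show "\<rho> T_mat v \<delta> = e_qmodz (Q \<delta>) * v \<delta>" .
qed

lemma weil_S:
  assumes "finite (carrier D)" "v \<in> group_alg D"
  shows "\<rho> S_mat v \<beta> = (if \<beta> \<in> carrier D then
    ee (- of_int (signature D Q) / 8) / of_real (sqrt (card (carrier D))) *
    (\<Sum>\<gamma>\<in>carrier D. e_qmodz (- bform D Q \<gamma> \<beta>) * v \<gamma>) else 0)"
proof (cases "\<beta> \<in> carrier D")
  case True
  have "\<rho> S_mat v \<beta> = (\<Sum>\<gamma>\<in>carrier D. v \<gamma> *
      (ee (- of_int (signature D Q) / 8) / of_real (sqrt (card (carrier D))) *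
      (\<Sum>\<beta>'\<in>carrier D. e_qmodz (- bform D Q \<gamma> \<beta>') * basis_vec \<beta>' \<beta>)))"
    using alg_linear_expand[OF weil_alg_linear[OF S_mat_in_SL2Z] assms, of \<beta>] weil
    by (simp add: weil_representation_def)
  also have "\<dots> = (\<Sum>\<gamma>\<in>carrier D. v \<gamma> *
      (ee (- of_int (signature D Q) / 8) / of_real (sqrt (card (carrier D))) * e_qmodz (- bform D Q \<gamma> \<beta>)))"
    using True assms by (simp add: basis_vec_def if_distrib cong: if_cong)
  finally show ?thesis using True by (simp add: sum_distrib_left sum_divide_distrib algebra_simps)
next
  case False
  then show ?thesis using weil_closed[OF S_mat_in_SL2Z assms(2)] by (simp add: group_alg_def)
qed

text \<open>Induction over words in the generators. Commutation with the inverse of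
  \<open>T_mat\<close> is not assumed but obtained by inverting \<rho> at \<open>T_mat\<close> on
  both sides.\<close>

lemma weil_commute:
  assumes L: "\<And>v. v \<in> group_alg D \<Longrightarrow> L v \<in> group_alg D"
    and S: "\<And>v. v \<in> group_alg D \<Longrightarrow> L (\<rho> S_mat v) = \<rho> S_mat (L v)"
    and T: "\<And>v. v \<in> group_alg D \<Longrightarrow> L (\<rho> T_mat v) = \<rho> T_mat (L v)"
    and "M \<in> SL2Z" "v \<in> group_alg D"
  shows "L (\<rho> M v) = \<rho> M (L v)"
proof -
  let ?T' = "translation_mat (- 1)"
  have TT': "T_mat ** ?T' = mat 1" "?T' ** T_mat = mat 1"
    by (intro matrix_2_eqI; simp add: translation_mat_def T_mat_def mult_2x2)+
  have T': "L (\<rho> ?T' v) = \<rho> ?T' (L v)" if v: "v \<in> group_alg D" for v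
  proof -
    define w where "w = \<rho> ?T' v"
    have w: "w \<in> group_alg D" unfolding w_def using v by (simp add: weil_closed)
    have "\<rho> T_mat w = v"
      unfolding w_def using weil_mult[of T_mat ?T' v] v by (simp add: TT' weil_one)
    then have "L v = \<rho> T_mat (L w)" using T[OF w] by simp
    then have "\<rho> ?T' (L v) = L w"
      using weil_mult[of ?T' T_mat "L w"] L[OF w] by (simp add: TT' weil_one)
    then show ?thesis by (simp add: w_def)
  qed
  from \<open>M \<in> SL2Z\<close> show ?thesis using \<open>v \<in> group_alg D\<close>
    by (induction M rule: SL2Z_induct) (simp_all add: weil_one weil_mult weil_closed L S T T')
qed

end

section \<open>Descent of the Weil representation to the quotient\<close>

context isotropic_subgroup
begin

text \<open>For \<open>T_mat\<close> this is constancy of \<open>Q\<close> on cosets in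
  \<open>H\<^sub>p\<close>. \<open>S_mat\<close> acts as a Fourier transform, which exchanges
  summation over \<open>H\<close> with restriction to \<open>H\<^sub>p\<close>; \<open>up\<close>
  after \<open>down\<close> does both. Either side at \<open>\<beta>\<close> is 0 outside
  \<open>H\<^sub>p\<close>, and on \<open>H\<^sub>p\<close> it is \<open>c * card H\<close> times
  the transform of \<open>v\<close> restricted to \<open>H\<^sub>p\<close>.\<close>

lemma up_down_commute_weil:
  assumes weil: "weil_representation D Q \<rho>" and "M \<in> SL2Z" "v \<in> group_alg D"
  shows "up D Q H (down D Q H (\<rho> M v)) = \<rho> M (up D Q H (down D Q H v))"
proof (rule weil_commute[OF weil, where L = "\<lambda>v. up D Q H (down D Q H v)"])
  fix v assume v: "v \<in> group_alg D"
  show "up D Q H (down D Q H (\<rho> T_mat v)) = \<rho> T_mat (up D Q H (down D Q H v))"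
    using v by (simp add: fun_eq_iff weil_T[OF weil finite_carrier] up_in_group_alg up_down_apply
        Q_mult_H sum_distrib_left)
  define c where "c = ee (- of_int (signature D Q) / 8) / of_real (sqrt (card (carrier D)))"
  note S = weil_S[OF weil finite_carrier, folded c_def]
  show "up D Q H (down D Q H (\<rho> S_mat v)) = \<rho> S_mat (up D Q H (down D Q H v))"
  proof
    fix \<beta>
    show "up D Q H (down D Q H (\<rho> S_mat v)) \<beta> = \<rho> S_mat (up D Q H (down D Q H v)) \<beta>"
    proof (cases "\<beta> \<in> carrier D")
      case False
      then show ?thesis by (auto simp: up_down_apply S up_in_group_alg perp_carrier)
    next
      case \<beta>: True
      have inv_sum: "(\<Sum>h\<in>H. e_qmodz (- bform D Q \<gamma> h)) = (if \<gamma> \<in> H\<^sub>p then of_nat (card H) else 0)"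
        if "\<gamma> \<in> carrier D" for \<gamma>
      proof -
        have "(\<Sum>h\<in>H. e_qmodz (- bform D Q \<gamma> h)) = (\<Sum>h\<in>H. e_qmodz (bform D Q (inv \<gamma>) h))"
          using that by (simp add: bform_inv_left H_carrier)
        also have "\<dots> = (if inv \<gamma> \<in> H\<^sub>p then of_nat (card H) else 0)"
          using that by (intro sum_bform_H) simp
        also have "inv \<gamma> \<in> H\<^sub>p \<longleftrightarrow> \<gamma> \<in> H\<^sub>p"
          using that by (auto simp: perp_def bform_inv_left H_carrier)
        finally show ?thesis .
      qed
      have restrict: "(\<Sum>\<gamma>\<in>carrier D. if \<gamma> \<in> H\<^sub>p then g \<gamma> else 0) = (\<Sum>\<gamma>\<in>H\<^sub>p. g \<gamma>)" for g :: "'a \<Rightarrow> complex"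
        using finite_carrier perp_carrier by (intro sum.mono_neutral_cong_right) auto
      have "\<rho> S_mat (up D Q H (down D Q H v)) \<beta>
          = c * (\<Sum>\<gamma>\<in>carrier D. if \<gamma> \<in> H\<^sub>p then \<Sum>h\<in>H. e_qmodz (- bform D Q \<gamma> \<beta>) * v (\<gamma> \<otimes> h) else 0)"
        using \<beta> by (simp add: S up_in_group_alg up_down_apply sum_distrib_left if_distrib cong: if_cong)
      also have "\<dots> = c * (\<Sum>h\<in>H. \<Sum>\<gamma>\<in>H\<^sub>p. e_qmodz (- bform D Q \<gamma> \<beta>) * v (\<gamma> \<otimes> h))"
        unfolding restrict by (subst sum.swap) simp
      \<comment> \<open>Splitting off the character value at \<open>h\<close> leaves a function of
        \<open>\<gamma> \<otimes> h\<close> alone, so the translation by \<open>h\<close> can be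
        removed from the sum over \<open>H\<^sub>p\<close>.\<close>
      also have "\<dots> = c * (\<Sum>h\<in>H. \<Sum>\<gamma>\<in>H\<^sub>p. e_qmodz (bform D Q \<beta> h) * (e_qmodz (- bform D Q (\<gamma> \<otimes> h) \<beta>) * v (\<gamma> \<otimes> h)))"
      proof (intro arg_cong[of _ _ "(*) c"] sum.cong refl)
        fix h \<gamma> assume "h \<in> H" "\<gamma> \<in> H\<^sub>p"
        then have "- bform D Q \<gamma> \<beta> = bform D Q \<beta> h + - bform D Q (\<gamma> \<otimes> h) \<beta>"
          using \<beta> by (simp add: bform_mult perp_carrier H_carrier bform_commute[of h])
        then show "e_qmodz (- bform D Q \<gamma> \<beta>) * v (\<gamma> \<otimes> h)
            = e_qmodz (bform D Q \<beta> h) * (e_qmodz (- bform D Q (\<gamma> \<otimes> h) \<beta>) * v (\<gamma> \<otimes> h))"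
          by (simp only: e_qmodz_add mult.assoc)
      qed
      also have "\<dots> = c * (\<Sum>h\<in>H. e_qmodz (bform D Q \<beta> h) * (\<Sum>\<gamma>\<in>H\<^sub>p. e_qmodz (- bform D Q \<gamma> \<beta>) * v \<gamma>))"
        unfolding sum_distrib_left[symmetric]
        using sum_subgroup_translate[OF subgroup_perp H_subset_perp,
            of _ "\<lambda>\<gamma>. e_qmodz (- bform D Q \<gamma> \<beta>) * v \<gamma>"] by simp
      also have "\<dots> = c * ((if \<beta> \<in> H\<^sub>p then of_nat (card H) else 0) * (\<Sum>\<gamma>\<in>H\<^sub>p. e_qmodz (- bform D Q \<gamma> \<beta>) * v \<gamma>))"
        using sum_bform_H[OF \<beta>] by (simp flip: sum_distrib_right)
      also have "\<dots> = up D Q H (down D Q H (\<rho> S_mat v)) \<beta>"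
      proof (cases "\<beta> \<in> H\<^sub>p")
        case True
        have "up D Q H (down D Q H (\<rho> S_mat v)) \<beta>
            = (\<Sum>h\<in>H. c * (\<Sum>\<gamma>\<in>carrier D. e_qmodz (- bform D Q \<gamma> (\<beta> \<otimes> h)) * v \<gamma>))"
          using True \<beta> v by (simp add: up_down_apply S H_carrier)
        also have "\<dots> = c * (\<Sum>\<gamma>\<in>carrier D. \<Sum>h\<in>H. e_qmodz (- bform D Q \<gamma> (\<beta> \<otimes> h)) * v \<gamma>)"
          unfolding sum_distrib_left by (rule sum.swap)
        also have "\<dots> = c * (\<Sum>\<gamma>\<in>carrier D. (\<Sum>h\<in>H. e_qmodz (- bform D Q \<gamma> h)) * (e_qmodz (- bform D Q \<gamma> \<beta>) * v \<gamma>))"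
          unfolding sum_distrib_right
        proof (intro arg_cong[of _ _ "(*) c"] sum.cong refl)
          fix \<gamma> h assume "\<gamma> \<in> carrier D" "h \<in> H"
          then have "- bform D Q \<gamma> (\<beta> \<otimes> h) = - bform D Q \<gamma> h + - bform D Q \<gamma> \<beta>"
            using \<beta> by (simp add: bform_mult_right H_carrier)
          then show "e_qmodz (- bform D Q \<gamma> (\<beta> \<otimes> h)) * v \<gamma>
              = e_qmodz (- bform D Q \<gamma> h) * (e_qmodz (- bform D Q \<gamma> \<beta>) * v \<gamma>)"
            by (simp only: e_qmodz_add mult.assoc)
        qed
        also have "\<dots> = c * (\<Sum>\<gamma>\<in>carrier D. if \<gamma> \<in> H\<^sub>p then of_nat (card H) * (e_qmodz (- bform D Q \<gamma> \<beta>) * v \<gamma>) else 0)"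
          by (intro arg_cong[of _ _ "(*) c"] sum.cong refl) (simp add: inv_sum)
        also have "\<dots> = c * (of_nat (card H) * (\<Sum>\<gamma>\<in>H\<^sub>p. e_qmodz (- bform D Q \<gamma> \<beta>) * v \<gamma>))"
          unfolding restrict by (simp add: sum_distrib_left)
        finally show ?thesis using True by simp
      qed (simp add: up_down_apply)
      finally show ?thesis by simp
    qed
  qed
qed (use assms in \<open>auto intro: up_in_group_alg\<close>)

text \<open>Since \<open>down \<circ> up\<close> is multiplication by \<open>|H|\<close>, this is \<open>\<rho>\<close> restricted to the image of \<open>up\<close>.\<close>

definition quot_weil :: "(int ^ 2 ^ 2 \<Rightarrow> ('a \<Rightarrow> complex) \<Rightarrow> 'a \<Rightarrow> complex) \<Rightarrow> int ^ 2 ^ 2 \<Rightarrow> ('a set \<Rightarrow> complex) \<Rightarrow> 'a set \<Rightarrow> complex"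
  where "quot_weil \<rho> M w = (\<lambda>\<alpha>. 1 / of_nat (card H) * down D Q H (\<rho> M (up D Q H w)) \<alpha>)"

text \<open>\<open>down\<close> intertwines \<rho> with \<open>quot_weil \<rho>\<close>: moving
  \<rho> inside \<open>up\<close> after \<open>down\<close> leaves \<open>down\<close> applied to an
  \<open>up\<close>, and the resulting factor \<open>card H\<close> cancels the
  normalisation.\<close>

lemma quot_weil_down:
  assumes weil: "weil_representation D Q \<rho>" and "M \<in> SL2Z" "v \<in> group_alg D"
  shows "quot_weil \<rho> M (down D Q H v) = down D Q H (\<rho> M v)"
  unfolding quot_weil_def up_down_commute_weil[OF assms, symmetric]
  by (subst down_up) (auto intro: down_in_group_alg)

text \<open>Multiplicativity follows from \<open>quot_weil_down\<close>, because
  \<open>quot_weil \<rho> M' w\<close> is itself a multiple of an image under \<open>down\<close>.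
  For \<open>S_mat\<close> the constants have to match as well: the sum over
  \<open>H\<^sub>p\<close> is \<open>card H\<close> times the sum over cosets, and that factor turns
  \<open>c\<close> into \<open>c'\<close>.\<close>

lemma weil_representation_quot:
  assumes weil: "weil_representation D Q \<rho>"
  shows "weil_representation D\<^sub>H (quot_form Q) (quot_weil \<rho>)"
proof -
  define \<kappa> where "\<kappa> = (1 / of_nat (card H) :: complex)"
  have \<kappa>: "\<kappa> * of_nat (card H) = 1" by (simp add: \<kappa>_def)
  note def = quot_weil_def[folded \<kappa>_def]
  have lin: "alg_linear D\<^sub>H (quot_weil \<rho> M)" if "M \<in> SL2Z" for M
  proof -
    have "alg_linear D\<^sub>H (\<lambda>w. \<rho> M (up D Q H w))"
      by (rule alg_linear_compose[OF alg_linear_up weil_alg_linear[OF weil that]]) (rule up_in_group_alg)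
    then have "alg_linear D\<^sub>H (\<lambda>w. down D Q H (\<rho> M (up D Q H w)))"
      by (rule alg_linear_compose[where E = D]) (intro alg_linear_down weil_closed[OF weil that] up_in_group_alg)+
    then show ?thesis
      by (simp add: alg_linear_def def algebra_simps)
  qed
  have cl: "quot_weil \<rho> M w \<in> group_alg D\<^sub>H" for M w
    using down_in_group_alg[of "\<rho> M (up D Q H w)"] by (simp add: def group_alg_def)
  have one: "quot_weil \<rho> (mat 1) w = w" if "w \<in> group_alg D\<^sub>H" for w
    using that \<kappa> by (simp add: def weil_one[OF weil] up_in_group_alg down_up flip: mult.assoc)
  have mult: "quot_weil \<rho> (M ** M') w = quot_weil \<rho> M (quot_weil \<rho> M' w)"
    if "M \<in> SL2Z" "M' \<in> SL2Z" "w \<in> group_alg D\<^sub>H" for M M' w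
  proof -
    define u where "u = \<rho> M' (up D Q H w)"
    have u: "u \<in> group_alg D"
      unfolding u_def by (rule weil_closed[OF weil that(2) up_in_group_alg])
    have "quot_weil \<rho> M (quot_weil \<rho> M' w) = quot_weil \<rho> M (\<lambda>\<alpha>. \<kappa> * down D Q H u \<alpha>)"
      by (simp add: def u_def)
    also have "\<dots> = (\<lambda>\<alpha>. \<kappa> * quot_weil \<rho> M (down D Q H u) \<alpha>)"
      by (rule alg_linear_scale[OF lin[OF that(1)] down_in_group_alg])
    also have "\<dots> = (\<lambda>\<alpha>. \<kappa> * down D Q H (\<rho> M u) \<alpha>)"
      by (simp add: quot_weil_down[OF weil that(1) u])
    finally show ?thesis
      unfolding u_def def by (simp add: weil_mult[OF weil that(1,2) up_in_group_alg])
  qed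
  have T: "quot_weil \<rho> T_mat w = (\<lambda>\<beta>. e_qmodz (quot_form Q \<beta>) * w \<beta>)" if w: "w \<in> group_alg D\<^sub>H" for w
  proof
    fix \<beta>
    show "quot_weil \<rho> T_mat w \<beta> = e_qmodz (quot_form Q \<beta>) * w \<beta>"
    proof (cases "\<beta> \<in> carrier D\<^sub>H")
      case True
      then obtain \<delta> where \<delta>: "\<delta> \<in> H\<^sub>p" "\<beta> = H #> \<delta>" by (rule quotE)
      then show ?thesis using \<kappa>
        by (simp add: def weil_T[OF weil finite_carrier up_in_group_alg] down_coset Q_mult_H up_apply
            perp_mult_H_iff perp_carrier flip: mult.assoc)
    next
      case False
      then show ?thesis using cl[of T_mat w] w by (simp add: group_alg_def)
    qed
  qed
  define c where "c = ee (- of_int (signature D Q) / 8) / of_real (sqrt (card (carrier D)))"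
  define c' where "c' = ee (- of_int (signature D\<^sub>H (quot_form Q)) / 8) / of_real (sqrt (card (carrier D\<^sub>H)))"
  \<comment> \<open>Equal signatures make the roots of unity agree; the square roots of the group
    orders differ by the factor \<open>card H\<close>.\<close>
  have c': "c' = c * of_nat (card H)"
    unfolding c_def c'_def signature_quot sqrt_card_carrier by simp
  have S: "quot_weil \<rho> S_mat w (H #> \<delta>)
      = c' * (\<Sum>\<alpha>\<in>carrier D\<^sub>H. e_qmodz (- bform D\<^sub>H (quot_form Q) \<alpha> (H #> \<delta>)) * w \<alpha>)"
    if \<delta>: "\<delta> \<in> H\<^sub>p" for w \<delta>
  proof -
    have "\<rho> S_mat (up D Q H w) (\<delta> \<otimes> h)
        = c * (\<Sum>\<gamma>\<in>H\<^sub>p. e_qmodz (- bform D\<^sub>H (quot_form Q) (H #> \<gamma>) (H #> \<delta>)) * w (H #> \<gamma>))"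
      if h: "h \<in> H" for h
    proof -
      have "(\<Sum>\<gamma>\<in>carrier D. e_qmodz (- bform D Q \<gamma> (\<delta> \<otimes> h)) * up D Q H w \<gamma>)
          = (\<Sum>\<gamma>\<in>H\<^sub>p. e_qmodz (- bform D\<^sub>H (quot_form Q) (H #> \<gamma>) (H #> \<delta>)) * w (H #> \<gamma>))"
        using finite_carrier perp_carrier \<delta> h
        by (intro sum.mono_neutral_cong_right)
           (auto simp: up_apply bform_mult_right bform_perp H_carrier)
      then show ?thesis
        using \<delta> h by (simp add: weil_S[OF weil finite_carrier up_in_group_alg] perp_carrier H_carrier c_def)
    qed
    then have "quot_weil \<rho> S_mat w (H #> \<delta>) = \<kappa> * of_nat (card H) *
        (c * (\<Sum>\<gamma>\<in>H\<^sub>p. e_qmodz (- bform D\<^sub>H (quot_form Q) (H #> \<gamma>) (H #> \<delta>)) * w (H #> \<gamma>)))"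
      using \<delta> by (simp add: def down_coset)
    then show ?thesis
      unfolding \<kappa> c' sum_perp_coset[of "\<lambda>\<alpha>. e_qmodz (- bform D\<^sub>H (quot_form Q) \<alpha> (H #> \<delta>)) * w \<alpha>"]
      by simp
  qed
  have S_basis: "quot_weil \<rho> S_mat (basis_vec \<alpha>)
      = (\<lambda>\<delta>. c' * (\<Sum>\<beta>\<in>carrier D\<^sub>H. e_qmodz (- bform D\<^sub>H (quot_form Q) \<alpha> \<beta>) * basis_vec \<beta> \<delta>))"
    if \<alpha>: "\<alpha> \<in> carrier D\<^sub>H" for \<alpha>
  proof
    fix \<beta>
    have sum_basis: "(\<Sum>\<beta>'\<in>carrier D\<^sub>H. g \<beta>' * basis_vec \<beta>' \<beta>) = (if \<beta> \<in> carrier D\<^sub>H then g \<beta> else 0)" for g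
      by (simp add: basis_vec_def if_distrib cong: if_cong)
    have sum_basis': "(\<Sum>\<beta>'\<in>carrier D\<^sub>H. g \<beta>' * basis_vec \<alpha> \<beta>') = g \<alpha>" for g
      using \<alpha> by (simp add: basis_vec_def if_distrib cong: if_cong)
    show "quot_weil \<rho> S_mat (basis_vec \<alpha>) \<beta>
        = c' * (\<Sum>\<beta>'\<in>carrier D\<^sub>H. e_qmodz (- bform D\<^sub>H (quot_form Q) \<alpha> \<beta>') * basis_vec \<beta>' \<beta>)"
    proof (cases "\<beta> \<in> carrier D\<^sub>H")
      case True
      then obtain \<delta> where \<delta>: "\<delta> \<in> H\<^sub>p" "\<beta> = H #> \<delta>" by (rule quotE)
      then show ?thesis
        unfolding sum_basis using S[OF \<delta>(1), of "basis_vec \<alpha>"] by (simp add: sum_basis')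
    next
      case False
      then show ?thesis unfolding sum_basis using cl[of S_mat "basis_vec \<alpha>"] by (simp add: group_alg_def)
    qed
  qed
  show ?thesis
    unfolding weil_representation_def
  proof (intro conjI ballI allI)
    fix \<gamma> assume "\<gamma> \<in> carrier D\<^sub>H"
    then show "quot_weil \<rho> T_mat (basis_vec \<gamma>) = (\<lambda>\<delta>. e_qmodz (quot_form Q \<gamma>) * basis_vec \<gamma> \<delta>)"
      using T[OF group_alg_basis_vec] by (auto simp: basis_vec_def)
    show "quot_weil \<rho> S_mat (basis_vec \<gamma>) =
        (\<lambda>\<delta>. ee (- of_int (signature D\<^sub>H (quot_form Q)) / 8) / of_real (sqrt (card (carrier D\<^sub>H))) *
              (\<Sum>\<beta>\<in>carrier D\<^sub>H. e_qmodz (- bform D\<^sub>H (quot_form Q) \<gamma> \<beta>) * basis_vec \<beta> \<delta>))"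
      using S_basis[OF \<open>\<gamma> \<in> carrier D\<^sub>H\<close>] unfolding c'_def .
  qed (use cl one mult lin[unfolded alg_linear_def] in simp_all)
qed

end

section \<open>Sums of up and down maps\<close>

text \<open>Gaussian elimination, one coordinate at a time. The vectors form an indexed family, so
  coinciding vectors count separately; powers of an operator may well repeat.\<close>

lemma finite_linear_dependence:
  fixes f :: "'j \<Rightarrow> 'x \<Rightarrow> complex"
  assumes "finite X" "finite J" "card X < card J"
  shows "\<exists>c. (\<exists>j\<in>J. c j \<noteq> 0) \<and> (\<forall>x\<in>X. (\<Sum>j\<in>J. c j * f j x) = 0)"
  using assms
proof (induction X arbitrary: J f rule: finite_induct)
  case empty
  then have "J \<noteq> {}" by auto
  then show ?case by (intro exI[of _ "\<lambda>_. 1"]) auto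
next
  case (insert x X)
  show ?case
  proof (cases "\<forall>j\<in>J. f j x = 0")
    case True
    obtain c where "\<exists>j\<in>J. c j \<noteq> 0" "\<forall>y\<in>X. (\<Sum>j\<in>J. c j * f j y) = 0"
      using insert.IH[of J f] insert.prems insert.hyps by auto
    with True show ?thesis by (intro exI[of _ c]) auto
  next
    case False
    then obtain p where p: "p \<in> J" "f p x \<noteq> 0" by blast
    define J' where "J' = J - {p}"
    have J: "J = insert p J'" "p \<notin> J'" "finite J'"
      using p insert.prems by (auto simp: J'_def)
    \<comment> \<open>Subtracting a multiple of the pivot row \<open>f p\<close> clears coordinate
      \<open>x\<close>.\<close>
    define f' where "f' j y = f j y - f j x / f p x * f p y" for j y
    obtain c where c: "\<exists>j\<in>J'. c j \<noteq> 0" "\<forall>y\<in>X. (\<Sum>j\<in>J'. c j * f' j y) = 0"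
      using insert.IH[of J' f'] insert.prems insert.hyps J by auto
    \<comment> \<open>The coefficient at the pivot collects all the multiples of \<open>f p\<close>
      that were subtracted.\<close>
    define c' where "c' = c(p := - (\<Sum>j\<in>J'. c j * f j x / f p x))"
    have "(\<Sum>j\<in>J. c' j * f j y) = (\<Sum>j\<in>J'. c j * f' j y)" for y
    proof -
      have "(\<Sum>j\<in>J'. c' j * f j y) = (\<Sum>j\<in>J'. c j * f j y)"
        using J by (intro sum.cong) (auto simp: c'_def)
      then have "(\<Sum>j\<in>J. c' j * f j y) = (\<Sum>j\<in>J'. c j * f j y) - (\<Sum>j\<in>J'. c j * f j x / f p x) * f p y"
        using J by (simp add: c'_def)
      also have "\<dots> = (\<Sum>j\<in>J'. c j * f' j y)"
        by (simp add: f'_def sum_distrib_right right_diff_distrib mult.assoc flip: sum_subtractf)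
      finally show ?thesis .
    qed
    moreover have "f' j x = 0" for j using p by (simp add: f'_def)
    moreover have "\<exists>j\<in>J. c' j \<noteq> 0" using c(1) J by (auto simp: c'_def)
    ultimately show ?thesis using c(2) by (intro exI[of _ c']) auto
  qed
qed

text \<open>Components of the image are finite linear combinations of components of
  \<open>F\<close>, which gives all analytic conditions; the transformation law needs
  \<open>L\<close> to commute with the \<rho> under which \<open>F\<close> transforms, hence \<rho>
  is explicit here.\<close>

lemma vv_cusp_forms_linear_image:
  assumes F: "F \<in> vv_cusp_forms D Q k" and fin: "finite (carrier D)"
    and equivariant: "\<And>M \<tau>. M \<in> SL2Z \<Longrightarrow> \<tau> \<in> upper_half \<Longrightarrow>
        F (moebius M \<tau>) = (\<lambda>\<gamma>. aut_factor M \<tau> powi k * \<rho> M (F \<tau>) \<gamma>)"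
    and weil: "weil_representation D Q \<rho>" and weil': "weil_representation D' Q' \<rho>'"
    and lin: "alg_linear D L" and closed: "\<And>v. v \<in> group_alg D \<Longrightarrow> L v \<in> group_alg D'"
    and commute: "\<And>M v. M \<in> SL2Z \<Longrightarrow> v \<in> group_alg D \<Longrightarrow> L (\<rho> M v) = \<rho>' M (L v)"
  shows "(\<lambda>\<tau>. L (F \<tau>)) \<in> vv_cusp_forms D' Q' k"
proof -
  have F_alg: "F \<tau> \<in> group_alg D" for \<tau>
    using F by (simp add: vv_cusp_forms_def vv_modular_forms_def)
  have cusp: "\<exists>N>0. cusp_form N k (\<lambda>\<tau>. L (F \<tau>) x)" for x
  proof -
    have "\<exists>N>0. cusp_form N k (\<lambda>\<tau>. \<Sum>\<gamma>\<in>carrier D. L (basis_vec \<gamma>) x * F \<tau> \<gamma>)"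
      using F by (intro cusp_form_sum[OF fin]) (auto simp: vv_cusp_forms_def)
    then show ?thesis
      by (simp add: alg_linear_expand[OF lin fin F_alg] mult.commute)
  qed
  have zero: "L (\<lambda>\<gamma>. 0) = (\<lambda>x. 0)"
    using alg_linear_sum[OF lin, of "{}"] by simp
  have "(\<lambda>\<tau>. L (F \<tau>)) \<in> vv_modular_forms D' Q' k"
    unfolding vv_modular_forms_def
  proof (intro CollectI conjI allI impI ballI)
    show "L (F \<tau>) \<in> group_alg D'" for \<tau> by (intro closed F_alg)
    show "L (F \<tau>) = (\<lambda>\<gamma>. 0)" if "\<tau> \<notin> upper_half" for \<tau>
      using F that zero by (simp add: vv_cusp_forms_def vv_modular_forms_def)
    show "(\<lambda>\<tau>. L (F \<tau>) \<gamma>) holomorphic_on upper_half" for \<gamma>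
      using cusp[of \<gamma>] by (auto simp: cusp_form_def modular_form_def)
    show "bounded_at_infinity (\<lambda>\<tau>. L (F \<tau>) \<gamma>)" for \<gamma>
      using cusp[of \<gamma>] modular_form_imp_bounded by (auto simp: cusp_form_def)
    have "L (F (moebius M \<tau>)) = (\<lambda>\<gamma>. aut_factor M \<tau> powi k * \<rho>' M (L (F \<tau>)) \<gamma>)"
      if "M \<in> SL2Z" "\<tau> \<in> upper_half" for M \<tau>
      using that alg_linear_scale[OF lin weil_closed[OF weil that(1) F_alg]]
      by (simp add: equivariant commute F_alg)
    then show "\<exists>\<rho>'. weil_representation D' Q' \<rho>' \<and> (\<forall>M\<in>SL2Z. \<forall>\<tau>\<in>upper_half.
        L (F (moebius M \<tau>)) = (\<lambda>\<gamma>. aut_factor M \<tau> powi k * \<rho>' M (L (F \<tau>)) \<gamma>))"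
      using weil' by blast
  qed
  then show ?thesis using cusp by (simp add: vv_cusp_forms_def)
qed

section \<open>The operator \<open>up_down\<close> and its pseudo-inverse\<close>

locale isotropic_family = discriminant_form +
  fixes n :: nat and H :: "nat \<Rightarrow> 'a set"
  assumes isotropic_family: "\<And>i. i \<in> {1..n} \<Longrightarrow> isotropic D Q (H i)"
begin

lemma isotropic_subgroup: "i \<in> {1..n} \<Longrightarrow> isotropic_subgroup D Q (H i)"
  by (intro isotropic_subgroup.intro isotropic_subgroup_axioms.intro discriminant_form_axioms isotropic_family)

abbreviation up\<^sub>i :: "nat \<Rightarrow> ('a set \<Rightarrow> complex) \<Rightarrow> 'a \<Rightarrow> complex" where "up\<^sub>i i \<equiv> up D Q (H i)"
abbreviation down\<^sub>i :: "nat \<Rightarrow> ('a \<Rightarrow> complex) \<Rightarrow> 'a set \<Rightarrow> complex" where "down\<^sub>i i \<equiv> down D Q (H i)"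
abbreviation D\<^sub>i :: "nat \<Rightarrow> 'a set monoid" where "D\<^sub>i i \<equiv> quot_group D Q (H i)"

lemma up_alg: "i \<in> {1..n} \<Longrightarrow> up\<^sub>i i w \<in> group_alg D"
  and down_alg: "i \<in> {1..n} \<Longrightarrow> down\<^sub>i i v \<in> group_alg (D\<^sub>i i)"
  and adjoint: "i \<in> {1..n} \<Longrightarrow>
    (\<Sum>\<gamma>\<in>carrier D. up\<^sub>i i w \<gamma> * v \<gamma>) = (\<Sum>\<alpha>\<in>carrier (D\<^sub>i i). w \<alpha> * down\<^sub>i i v \<alpha>)"
  using isotropic_subgroup.up_in_group_alg[OF isotropic_subgroup]
    isotropic_subgroup.down_in_group_alg[OF isotropic_subgroup]
    isotropic_subgroup.up_down_adjoint[OF isotropic_subgroup] by blast+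

text \<open>The operator \<open>U\<close> of the overview.\<close>

definition up_down :: "('a \<Rightarrow> complex) \<Rightarrow> 'a \<Rightarrow> complex" where
  "up_down v = (\<lambda>\<gamma>. \<Sum>i=1..n. up\<^sub>i i (down\<^sub>i i v) \<gamma>)"

lemma up_down_closed: "up_down v \<in> group_alg D"
  using up_alg by (auto simp: up_down_def group_alg_def intro!: sum.neutral)

lemma alg_linear_up_down: "alg_linear D up_down"
proof -
  have "alg_linear D (\<lambda>v. up\<^sub>i i (down\<^sub>i i v))" if "i \<in> {1..n}" for i
    by (rule alg_linear_compose[OF alg_linear_down alg_linear_up]) (rule down_alg[OF that])
  then have "alg_linear D (\<lambda>v \<gamma>. \<Sum>i\<in>{1..n}. 1 * up\<^sub>i i (down\<^sub>i i v) \<gamma>)"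
    by (rule alg_linear_sum_ops)
  then show ?thesis by (simp add: up_down_def[abs_def])
qed

lemma up_down_commute:
  assumes weil: "weil_representation D Q \<rho>" and "M \<in> SL2Z" "v \<in> group_alg D"
  shows "up_down (\<rho> M v) = \<rho> M (up_down v)"
proof -
  have "\<rho> M (up_down v) = (\<lambda>\<gamma>. \<Sum>i=1..n. \<rho> M (up\<^sub>i i (down\<^sub>i i v)) \<gamma>)"
    using alg_linear_sum[OF weil_alg_linear[OF weil assms(2)], of "{1..n}" "\<lambda>i. up\<^sub>i i (down\<^sub>i i v)" "\<lambda>_. 1"] up_alg
    by (simp add: up_down_def)
  then show ?thesis
    using isotropic_subgroup.up_down_commute_weil[OF isotropic_subgroup assms]
    by (simp add: up_down_def)
qed

lemma up_down_form:
  "(\<Sum>\<gamma>\<in>carrier D. up_down v \<gamma> * w \<gamma>) = (\<Sum>i=1..n. \<Sum>\<alpha>\<in>carrier (D\<^sub>i i). down\<^sub>i i v \<alpha> * down\<^sub>i i w \<alpha>)"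
  unfolding up_down_def sum_distrib_right by (subst sum.swap) (simp add: adjoint)

lemma up_down_symmetric:
  "(\<Sum>\<gamma>\<in>carrier D. up_down v \<gamma> * w \<gamma>) = (\<Sum>\<gamma>\<in>carrier D. v \<gamma> * up_down w \<gamma>)"
  using up_down_form[of v w] up_down_form[of w v] by (simp add: mult.commute)

text \<open>\<open>down\<close> has real matrix entries. This turns the bilinear adjunction into a
  Hermitian one and makes positivity usable.\<close>

lemma down_cnj: "down\<^sub>i i (\<lambda>\<gamma>. cnj (v \<gamma>)) \<alpha> = cnj (down\<^sub>i i v \<alpha>)"
  unfolding down_def lin_ext_def cnj_sum by (intro sum.cong refl) (simp add: basis_vec_def)

lemma up_down_norm:
  "(\<Sum>\<gamma>\<in>carrier D. up_down v \<gamma> * cnj (v \<gamma>))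
    = of_real (\<Sum>i=1..n. \<Sum>\<alpha>\<in>carrier (D\<^sub>i i). (norm (down\<^sub>i i v \<alpha>))\<^sup>2)"
  by (simp add: up_down_form down_cnj complex_norm_square del: of_real_power)

lemma finite_D\<^sub>i: "i \<in> {1..n} \<Longrightarrow> finite (carrier (D\<^sub>i i))"
  using isotropic_subgroup.finite_quot[OF isotropic_subgroup] .

lemma up_down_eq_0_imp_down_eq_0:
  assumes "up_down v = (\<lambda>\<gamma>. 0)" "i \<in> {1..n}"
  shows "down\<^sub>i i v = (\<lambda>\<alpha>. 0)"
proof -
  have "(\<Sum>i=1..n. \<Sum>\<alpha>\<in>carrier (D\<^sub>i i). (norm (down\<^sub>i i v \<alpha>))\<^sup>2) = 0"
    using up_down_norm[of v] unfolding assms(1) by (simp del: of_real_sum)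
  then have "(\<Sum>\<alpha>\<in>carrier (D\<^sub>i i). (norm (down\<^sub>i i v \<alpha>))\<^sup>2) = 0"
    using assms(2) by (subst (asm) sum_nonneg_eq_0_iff) (auto intro: sum_nonneg)
  then have "down\<^sub>i i v \<alpha> = 0" if "\<alpha> \<in> carrier (D\<^sub>i i)" for \<alpha>
    using that finite_D\<^sub>i[OF assms(2)] by (subst (asm) sum_nonneg_eq_0_iff) auto
  then show ?thesis using down_alg[OF assms(2), of v] by (auto simp: group_alg_def)
qed

text \<open>If \<open>U (U v) = 0\<close>, then every \<open>down\<close> kills \<open>U v\<close>,
  and by adjunction \<open>U v\<close> has Hermitian product 0 with itself.\<close>

lemma up_down_up_down_eq_0:
  assumes "up_down (up_down v) = (\<lambda>\<gamma>. 0)"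
  shows "up_down v = (\<lambda>\<gamma>. 0)"
proof -
  have "(\<Sum>\<gamma>\<in>carrier D. up_down v \<gamma> * cnj (up_down v \<gamma>)) = 0"
    using up_down_eq_0_imp_down_eq_0[OF assms] by (simp add: up_down_form down_cnj)
  then have "complex_of_real (\<Sum>\<gamma>\<in>carrier D. (norm (up_down v \<gamma>))\<^sup>2) = 0"
    by (simp add: complex_norm_square del: of_real_power)
  then have "(\<Sum>\<gamma>\<in>carrier D. (norm (up_down v \<gamma>))\<^sup>2) = 0"
    by (simp only: of_real_eq_0_iff)
  then have "up_down v \<gamma> = 0" if "\<gamma> \<in> carrier D" for \<gamma>
    using that finite_carrier by (subst (asm) sum_nonneg_eq_0_iff) auto
  then show ?thesis using up_down_closed[of v] by (auto simp: group_alg_def)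
qed

lemma up_down_pow_closed: "v \<in> group_alg D \<Longrightarrow> (up_down ^^ j) v \<in> group_alg D"
  by (cases j) (auto simp: up_down_closed)

lemma alg_linear_up_down_pow: "alg_linear D (up_down ^^ j)"
proof (induction j)
  case 0
  show ?case by (simp add: alg_linear_def)
next
  case (Suc j)
  then show ?case
    using alg_linear_compose[OF Suc alg_linear_up_down up_down_pow_closed] by (simp add: o_def)
qed

lemma up_down_pow_commute:
  assumes "weil_representation D Q \<rho>" "M \<in> SL2Z" "v \<in> group_alg D"
  shows "(up_down ^^ j) (\<rho> M v) = \<rho> M ((up_down ^^ j) v)"
  by (induction j) (simp_all add: up_down_commute up_down_pow_closed assms)

lemma up_down_pow_symmetric:
  "(\<Sum>\<gamma>\<in>carrier D. (up_down ^^ j) v \<gamma> * w \<gamma>) = (\<Sum>\<gamma>\<in>carrier D. v \<gamma> * (up_down ^^ j) w \<gamma>)"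
proof (induction j arbitrary: w)
  case (Suc j)
  have "(\<Sum>\<gamma>\<in>carrier D. (up_down ^^ Suc j) v \<gamma> * w \<gamma>) = (\<Sum>\<gamma>\<in>carrier D. (up_down ^^ j) v \<gamma> * up_down w \<gamma>)"
    by (simp add: up_down_symmetric)
  then show ?case using Suc[of "up_down w"] by (simp add: funpow_swap1)
qed simp

lemma up_down_pow_eq_0:
  assumes "(up_down ^^ r) v = (\<lambda>\<gamma>. 0)" shows "up_down v = (\<lambda>\<gamma>. 0)"
proof -
  have zero: "up_down (\<lambda>\<gamma>. 0) = (\<lambda>\<gamma>. 0)"
    using alg_linear_sum[OF alg_linear_up_down, of "{}"] by simp
  show ?thesis using assms
  proof (induction r)
    case (Suc r)
    show ?case
    proof (cases r)
      case (Suc r')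
      then have "(up_down ^^ r) v = (\<lambda>\<gamma>. 0)"
        using Suc.prems up_down_up_down_eq_0[of "(up_down ^^ r') v"] by simp
      then show ?thesis by (rule Suc.IH)
    qed (use Suc.prems in simp)
  qed (simp add: zero)
qed

text \<open>A pseudo-inverse of \<open>up_down\<close> that is a polynomial in it, read off from an annihilating
  polynomial; the lowest-order coefficient can be isolated because \<open>up_down\<close> is self-adjoint,
  so that all its powers have the same kernel.\<close>

lemma up_down_pseudo_inverse:
  "\<exists>a m. \<forall>v\<in>group_alg D. \<forall>i\<in>{1..n}.
    down\<^sub>i i (\<lambda>\<gamma>. v \<gamma> - up_down (\<lambda>\<gamma>. \<Sum>j<m. a j * (up_down ^^ j) v \<gamma>) \<gamma>) = (\<lambda>\<alpha>. 0)"
proof -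
  \<comment> \<open>The number of entries of a matrix indexed by \<open>carrier D\<close>: among the
    \<open>m + 1\<close> powers with exponents \<open>0\<close> to \<open>m\<close>, viewed as such
    matrices, there is a linear relation.\<close>
  define m where "m = card (carrier D \<times> carrier D)"
  obtain c :: "nat \<Rightarrow> complex" where c_nz: "\<exists>j\<in>{..m}. c j \<noteq> 0"
    and c: "\<forall>x\<in>carrier D \<times> carrier D. (\<Sum>j\<le>m. c j * (\<lambda>(\<gamma>, \<delta>). (up_down ^^ j) (basis_vec \<gamma>) \<delta>) x) = 0"
    using finite_linear_dependence[of "carrier D \<times> carrier D" "{..m}"
        "\<lambda>j (\<gamma>, \<delta>). (up_down ^^ j) (basis_vec \<gamma>) \<delta>"] finite_carrier by (auto simp: m_def)
  have rel: "(\<lambda>\<delta>. \<Sum>j\<le>m. c j * (up_down ^^ j) v \<delta>) = (\<lambda>\<delta>. 0)" if v: "v \<in> group_alg D" for v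
  proof
    fix \<delta>
    show "(\<Sum>j\<le>m. c j * (up_down ^^ j) v \<delta>) = 0"
    proof (cases "\<delta> \<in> carrier D")
      case True
      have "(\<Sum>j\<le>m. c j * (up_down ^^ j) v \<delta>)
          = (\<Sum>j\<le>m. \<Sum>\<gamma>\<in>carrier D. v \<gamma> * (c j * (up_down ^^ j) (basis_vec \<gamma>) \<delta>))"
        by (simp add: alg_linear_expand[OF alg_linear_up_down_pow finite_carrier v] sum_distrib_left mult_ac)
      also have "\<dots> = (\<Sum>\<gamma>\<in>carrier D. v \<gamma> * (\<Sum>j\<le>m. c j * (up_down ^^ j) (basis_vec \<gamma>) \<delta>))"
        by (subst sum.swap) (simp add: sum_distrib_left)
      also have "\<dots> = 0" using c True by (intro sum.neutral) auto
      finally show ?thesis .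
    next
      case False
      then show ?thesis
        using up_down_pow_closed[OF v] by (auto simp: group_alg_def intro!: sum.neutral)
    qed
  qed
  define r where "r = (LEAST j. c j \<noteq> 0)"
  obtain j\<^sub>0 where j\<^sub>0: "j\<^sub>0 \<le> m" "c j\<^sub>0 \<noteq> 0" using c_nz by auto
  have r: "c r \<noteq> 0" "r \<le> m" "\<And>j. j < r \<Longrightarrow> c j = 0"
    unfolding r_def using LeastI[of "\<lambda>j. c j \<noteq> 0", OF j\<^sub>0(2)]
      order_trans[OF Least_le[of "\<lambda>j. c j \<noteq> 0", OF j\<^sub>0(2)] j\<^sub>0(1)] not_less_Least[of _ "\<lambda>j. c j \<noteq> 0"]
    by blast+
  define p where "p = m - r"
  \<comment> \<open>With \<open>w\<close> as below the relation reads \<open>U^r w = 0\<close>,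
    where \<open>w\<close> is \<open>c r * v\<close> plus terms divisible by \<open>U\<close>.
    Dividing by \<open>c r\<close> and moving these terms to the other side gives
    \<open>v - U (A v) = w / c r\<close> with exactly these coefficients for
    \<open>A\<close>.\<close>
  define a where "a j = - c (r + Suc j) / c r" for j
  show ?thesis
  proof (rule exI[of _ a], rule exI[of _ p], intro ballI)
    fix v i assume v: "v \<in> group_alg D" and i: "i \<in> {1..n}"
    define w where "w = (\<lambda>\<gamma>. \<Sum>j\<le>p. c (r + j) * (up_down ^^ j) v \<gamma>)"
    have w: "w \<in> group_alg D"
      unfolding w_def by (intro group_alg_sum up_down_pow_closed v)
    have "(up_down ^^ r) w = (\<lambda>\<delta>. \<Sum>j\<le>p. c (r + j) * (up_down ^^ r) ((up_down ^^ j) v) \<delta>)"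
      unfolding w_def by (rule alg_linear_sum[OF alg_linear_up_down_pow]) (simp_all add: up_down_pow_closed v)
    also have "\<dots> = (\<lambda>\<delta>. \<Sum>j\<le>m. c j * (up_down ^^ j) v \<delta>)"
    proof
      fix \<delta>
      have "(\<Sum>j\<le>m. c j * (up_down ^^ j) v \<delta>) = (\<Sum>j\<in>{r..m}. c j * (up_down ^^ j) v \<delta>)"
        using r(3) by (intro sum.mono_neutral_right) (auto simp: not_le)
      also have "\<dots> = (\<Sum>j\<le>p. c (r + j) * (up_down ^^ (r + j)) v \<delta>)"
        using r(2) by (intro sum.reindex_bij_witness[where i = "\<lambda>j. r + j" and j = "\<lambda>j. j - r"]) (auto simp: p_def)
      finally show "(\<Sum>j\<le>p. c (r + j) * (up_down ^^ r) ((up_down ^^ j) v) \<delta>) = (\<Sum>j\<le>m. c j * (up_down ^^ j) v \<delta>)"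
        by (simp add: funpow_add)
    qed
    finally have "up_down w = (\<lambda>\<gamma>. 0)"
      using rel[OF v] up_down_pow_eq_0 by simp
    then have "down\<^sub>i i w = (\<lambda>\<alpha>. 0)"
      using i by (rule up_down_eq_0_imp_down_eq_0)
    then have zero: "down\<^sub>i i (\<lambda>\<gamma>. 1 / c r * w \<gamma>) = (\<lambda>\<alpha>. 0)"
      unfolding alg_linear_scale[OF alg_linear_down w] by simp
    have A: "up_down (\<lambda>\<gamma>. \<Sum>j<p. a j * (up_down ^^ j) v \<gamma>) = (\<lambda>\<gamma>. \<Sum>j<p. a j * (up_down ^^ Suc j) v \<gamma>)"
      using alg_linear_sum[OF alg_linear_up_down, of "{..<p}" "\<lambda>j. (up_down ^^ j) v" a] up_down_pow_closed[OF v]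
      by simp
    have "1 / c r * w \<gamma> = v \<gamma> - up_down (\<lambda>\<gamma>. \<Sum>j<p. a j * (up_down ^^ j) v \<gamma>) \<gamma>" for \<gamma>
    proof -
      have "w \<gamma> = c r * v \<gamma> + (\<Sum>j<p. c (r + Suc j) * (up_down ^^ Suc j) v \<gamma>)"
        by (simp add: w_def sum.atMost_shift)
      then have "1 / c r * w \<gamma> = v \<gamma> + (\<Sum>j<p. 1 / c r * (c (r + Suc j) * (up_down ^^ Suc j) v \<gamma>))"
        unfolding sum_distrib_left[symmetric] using r(1) by (simp add: add_divide_distrib del: funpow.simps)
      also have "\<dots> = v \<gamma> - (\<Sum>j<p. a j * (up_down ^^ Suc j) v \<gamma>)"
        unfolding a_def by (simp add: sum_negf del: funpow.simps)
      finally show ?thesis unfolding A .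
    qed
    then show "down\<^sub>i i (\<lambda>\<gamma>. v \<gamma> - up_down (\<lambda>\<gamma>. \<Sum>j<p. a j * (up_down ^^ j) v \<gamma>) \<gamma>) = (\<lambda>\<alpha>. 0)"
      using zero by simp
  qed
qed

end

section \<open>Oldforms and newforms\<close>

context isotropic_family
begin

lemma up_func_all_eq:
  "up_func_all D Q n H G \<tau> \<gamma> = (\<Sum>i=1..n. up\<^sub>i i (G i \<tau>) \<gamma>)"
  unfolding up_func_all_def
  by (intro sum.cong refl) (simp add: isotropic_subgroup.up_func_eq_up[OF isotropic_subgroup])

text \<open>Evaluation is the bilinear pairing with \<open>F \<tau>\<close>, under which
  \<open>up\<close> transposes to \<open>down\<close>.\<close>

lemma eval_map_up:
  "i \<in> {1..n} \<Longrightarrow> eval_map D F (up\<^sub>i i w) \<tau> = (\<Sum>\<alpha>\<in>carrier (D\<^sub>i i). w \<alpha> * down\<^sub>i i (F \<tau>) \<alpha>)"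
  by (simp add: eval_map_def lin_ext_def adjoint)

lemma eval_map_up_func_all:
  "eval_map D (up_func_all D Q n H G) v \<tau> = (\<Sum>i=1..n. \<Sum>\<alpha>\<in>carrier (D\<^sub>i i). G i \<tau> \<alpha> * down\<^sub>i i v \<alpha>)"
proof -
  have "eval_map D (up_func_all D Q n H G) v \<tau> = (\<Sum>\<gamma>\<in>carrier D. \<Sum>i=1..n. up\<^sub>i i (G i \<tau>) \<gamma> * v \<gamma>)"
    by (simp add: eval_map_def lin_ext_def up_func_all_eq sum_distrib_left mult.commute)
  then show ?thesis by (subst (asm) sum.swap) (simp add: adjoint)
qed

lemma ker_down_all_iff:
  "v \<in> ker_down_all D Q n H \<longleftrightarrow> v \<in> group_alg D \<and> (\<forall>i\<in>{1..n}. down\<^sub>i i v = (\<lambda>\<alpha>. 0))"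
  unfolding ker_down_all_def down_all_def by (auto simp: restrict_def fun_eq_iff)

text \<open>Only the packaging differs: a preimage is chosen for each summand, and the resulting
  family is cut off outside \<open>{1..n}\<close> to become extensional.\<close>

lemma oldforms_eq_image: "oldforms D Q k n H = image_up_func_all D Q k n H"
proof (intro Set.set_eqI iffI)
  fix F assume "F \<in> oldforms D Q k n H"
  then obtain f where F: "F = (\<lambda>\<tau> \<gamma>. \<Sum>i=1..n. f i \<tau> \<gamma>)"
    and f: "\<forall>i\<in>{1..n}. f i \<in> up_func D Q (H i) ` vv_cusp_forms (D\<^sub>i i) (quot_form Q) k"
    unfolding oldforms_def by blast
  then have "\<forall>i\<in>{1..n}. \<exists>g. g \<in> vv_cusp_forms (D\<^sub>i i) (quot_form Q) k \<and> f i = up_func D Q (H i) g"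
    by blast
  then obtain G where G: "\<forall>i\<in>{1..n}. G i \<in> vv_cusp_forms (D\<^sub>i i) (quot_form Q) k \<and> f i = up_func D Q (H i) (G i)"
    by metis
  have "F = up_func_all D Q n H (restrict G {1..n})"
    unfolding F up_func_all_def using G by (intro ext sum.cong refl) simp
  moreover have "restrict G {1..n} \<in> (\<Pi>\<^sub>E i\<in>{1..n}. vv_cusp_forms (D\<^sub>i i) (quot_form Q) k)"
    using G by auto
  ultimately show "F \<in> image_up_func_all D Q k n H"
    unfolding image_up_func_all_def by blast
next
  fix F assume "F \<in> image_up_func_all D Q k n H"
  then obtain G where F: "F = up_func_all D Q n H G"
    and G: "G \<in> (\<Pi>\<^sub>E i\<in>{1..n}. vv_cusp_forms (D\<^sub>i i) (quot_form Q) k)"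
    unfolding image_up_func_all_def by blast
  then show "F \<in> oldforms D Q k n H"
    unfolding oldforms_def up_func_all_def
    by (intro CollectI exI[of _ "\<lambda>i. up_func D Q (H i) (G i)"]) auto
qed

end

locale isotropic_family_cusp_form = isotropic_family +
  fixes k :: int and F :: "complex \<Rightarrow> 'a \<Rightarrow> complex"
  assumes cusp: "F \<in> vv_cusp_forms D Q k"
begin

lemma F_alg: "F \<tau> \<in> group_alg D"
  using cusp by (simp add: vv_cusp_forms_def vv_modular_forms_def)

lemma F_outside: "\<tau> \<notin> upper_half \<Longrightarrow> F \<tau> = (\<lambda>\<gamma>. 0)"
  using cusp by (simp add: vv_cusp_forms_def vv_modular_forms_def)

text \<open>Every polynomial in \<open>up_down\<close> commutes with the Weil representation.\<close>

lemma down_polynomial_cusp_form: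
  assumes i: "i \<in> {1..n}"
  shows "(\<lambda>\<tau>. down\<^sub>i i (\<lambda>\<gamma>. \<Sum>j<m. a j * (up_down ^^ j) (F \<tau>) \<gamma>)) \<in> vv_cusp_forms (D\<^sub>i i) (quot_form Q) k"
proof -
  define A where "A v = (\<lambda>\<gamma>. \<Sum>j<m. a j * (up_down ^^ j) v \<gamma>)" for v
  obtain \<rho> where weil: "weil_representation D Q \<rho>"
    and equivariant: "\<And>M \<tau>. M \<in> SL2Z \<Longrightarrow> \<tau> \<in> upper_half \<Longrightarrow>
        F (moebius M \<tau>) = (\<lambda>\<gamma>. aut_factor M \<tau> powi k * \<rho> M (F \<tau>) \<gamma>)"
    using cusp unfolding vv_cusp_forms_def vv_modular_forms_def by blast
  interpret isotropic_subgroup D Q "H i" using i by (rule isotropic_subgroup)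
  have A_closed: "A v \<in> group_alg D" if "v \<in> group_alg D" for v
    unfolding A_def by (intro group_alg_sum up_down_pow_closed that)
  have A_lin: "alg_linear D A"
    unfolding A_def[abs_def] by (intro alg_linear_sum_ops alg_linear_up_down_pow)
  have A_commute: "A (\<rho> M v) = \<rho> M (A v)" if "M \<in> SL2Z" "v \<in> group_alg D" for M v
    unfolding A_def using that
    by (subst alg_linear_sum[OF weil_alg_linear[OF weil]])
       (simp_all add: up_down_pow_closed up_down_pow_commute[OF weil])
  have "(\<lambda>\<tau>. down D Q (H i) (A (F \<tau>))) \<in> vv_cusp_forms (D\<^sub>i i) (quot_form Q) k"
  proof (rule vv_cusp_forms_linear_image[OF cusp finite_carrier equivariant weil weil_representation_quot[OF weil]])
    show "alg_linear D (\<lambda>v. down D Q (H i) (A v))"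
      using A_lin alg_linear_down A_closed by (rule alg_linear_compose)
    show "down D Q (H i) (A (\<rho> M v)) = quot_weil \<rho> M (down D Q (H i) (A v))"
      if "M \<in> SL2Z" "v \<in> group_alg D" for M v
      using that by (simp add: A_commute quot_weil_down[OF weil] A_closed)
  qed (simp_all add: down_in_group_alg)
  then show ?thesis by (simp add: A_def)
qed

lemma down_cusp_form:
  assumes "i \<in> {1..n}"
  shows "(\<lambda>\<tau>. down\<^sub>i i (F \<tau>)) \<in> vv_cusp_forms (D\<^sub>i i) (quot_form Q) k"
  \<comment> \<open>The constant polynomial 1.\<close>
  using down_polynomial_cusp_form[OF assms, of "\<lambda>_. 1" 1] by simp

lemma in_image_iff:
  "F \<in> image_up_func_all D Q k n H \<longleftrightarrow> ker_down_all D Q n H \<subseteq> ker_eval_map D F"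
proof
  assume "F \<in> image_up_func_all D Q k n H"
  then obtain G where F: "F = up_func_all D Q n H G"
    unfolding image_up_func_all_def by blast
  show "ker_down_all D Q n H \<subseteq> ker_eval_map D F"
    by (auto simp: ker_down_all_iff ker_eval_map_def F eval_map_up_func_all)
next
  assume ker: "ker_down_all D Q n H \<subseteq> ker_eval_map D F"
  obtain a m where inverse: "\<And>v i. v \<in> group_alg D \<Longrightarrow> i \<in> {1..n} \<Longrightarrow>
      down\<^sub>i i (\<lambda>\<gamma>. v \<gamma> - up_down (\<lambda>\<gamma>. \<Sum>j<m. a j * (up_down ^^ j) v \<gamma>) \<gamma>) = (\<lambda>\<alpha>. 0)"
    using up_down_pseudo_inverse by blast
  define A where "A v = (\<lambda>\<gamma>. \<Sum>j<m. a j * (up_down ^^ j) v \<gamma>)" for v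
  have A_symmetric: "(\<Sum>\<gamma>\<in>carrier D. A v \<gamma> * w \<gamma>) = (\<Sum>\<gamma>\<in>carrier D. v \<gamma> * A w \<gamma>)" for v w
  proof -
    have "(\<Sum>\<gamma>\<in>carrier D. A v \<gamma> * w \<gamma>) = (\<Sum>\<gamma>\<in>carrier D. \<Sum>j<m. a j * ((up_down ^^ j) v \<gamma> * w \<gamma>))"
      by (simp add: A_def sum_distrib_right mult.assoc)
    also have "\<dots> = (\<Sum>j<m. a j * (\<Sum>\<gamma>\<in>carrier D. v \<gamma> * (up_down ^^ j) w \<gamma>))"
      by (subst sum.swap) (simp add: up_down_pow_symmetric flip: sum_distrib_left)
    also have "\<dots> = (\<Sum>\<gamma>\<in>carrier D. \<Sum>j<m. v \<gamma> * (a j * (up_down ^^ j) w \<gamma>))"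
      unfolding sum_distrib_left by (subst sum.swap) (simp add: mult.left_commute)
    finally show ?thesis by (simp add: A_def sum_distrib_left)
  qed
  have UA_symmetric: "(\<Sum>\<gamma>\<in>carrier D. up_down (A v) \<gamma> * w \<gamma>) = (\<Sum>\<gamma>\<in>carrier D. v \<gamma> * up_down (A w) \<gamma>)"
    if "w \<in> group_alg D" for v w
  proof -
    \<comment> \<open>A product of two symmetric operators is symmetric once they commute, and
      \<open>A\<close> is a polynomial in \<open>up_down\<close>.\<close>
    have "up_down (A w) = A (up_down w)"
      using alg_linear_sum[OF alg_linear_up_down, of "{..<m}" "\<lambda>j. (up_down ^^ j) w" a] up_down_pow_closed[OF that]
      by (simp add: A_def funpow_swap1)
    then show ?thesis by (simp add: up_down_symmetric A_symmetric)
  qed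
  have fixed: "up_down (A (F \<tau>)) = F \<tau>" for \<tau>
  proof
    fix \<delta>
    show "up_down (A (F \<tau>)) \<delta> = F \<tau> \<delta>"
    proof (cases "\<delta> \<in> carrier D")
      case False
      then show ?thesis using up_down_closed[of "A (F \<tau>)"] F_alg[of \<tau>] by (simp add: group_alg_def)
    next
      case True
      \<comment> \<open>This test vector is killed by all \<open>down\<close> maps, by the choice of
        \<open>A\<close>. That it is then killed by evaluation as well is the \<delta>-coordinate of
        the claim, after transposing \<open>U A\<close>.\<close>
      define v where "v = (\<lambda>\<gamma>. basis_vec \<delta> \<gamma> - up_down (A (basis_vec \<delta>)) \<gamma>)"
      have "v \<in> ker_down_all D Q n H"
        unfolding ker_down_all_iff v_def
        using inverse[of "basis_vec \<delta>"] group_alg_basis_vec[OF True] up_down_closed[of "A (basis_vec \<delta>)"]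
        by (simp add: A_def group_alg_def)
      then have "v \<in> ker_eval_map D F" using ker by blast
      then have "eval_map D F v \<tau> = 0"
        \<comment> \<open>The kernel condition speaks only of the upper half plane, but the equality
          of functions sought here covers all \<tau>; elsewhere \<open>F\<close> is 0.\<close>
        by (cases "\<tau> \<in> upper_half") (auto simp: ker_eval_map_def eval_map_def lin_ext_def F_outside)
      then have "(\<Sum>\<gamma>\<in>carrier D. basis_vec \<delta> \<gamma> * F \<tau> \<gamma>) = (\<Sum>\<gamma>\<in>carrier D. up_down (A (basis_vec \<delta>)) \<gamma> * F \<tau> \<gamma>)"
        by (simp add: eval_map_def lin_ext_def v_def left_diff_distrib sum_subtractf)
      also have "\<dots> = (\<Sum>\<gamma>\<in>carrier D. basis_vec \<delta> \<gamma> * up_down (A (F \<tau>)) \<gamma>)"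
        by (rule UA_symmetric[OF F_alg])
      finally show ?thesis
        using True finite_carrier by (simp add: basis_vec_def if_distribR if_distrib[of "\<lambda>x. x * _"] cong: if_cong)
    qed
  qed
  define G where "G = (\<lambda>i\<in>{1..n}. \<lambda>\<tau>. down\<^sub>i i (A (F \<tau>)))"
  have "G \<in> (\<Pi>\<^sub>E i\<in>{1..n}. vv_cusp_forms (D\<^sub>i i) (quot_form Q) k)"
    unfolding G_def A_def using down_polynomial_cusp_form by simp
  moreover have "F = up_func_all D Q n H G"
  proof (intro ext)
    fix \<tau> \<gamma>
    have "up_func_all D Q n H G \<tau> \<gamma> = up_down (A (F \<tau>)) \<gamma>"
      by (simp add: up_func_all_eq G_def up_down_def)
    then show "F \<tau> \<gamma> = up_func_all D Q n H G \<tau> \<gamma>" by (simp add: fixed)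
  qed
  ultimately show "F \<in> image_up_func_all D Q k n H"
    unfolding image_up_func_all_def by blast
qed

text \<open>Pairing \<open>F \<tau>\<close> with the image of a basis vector under \<open>up\<close>
  reads off one coordinate of \<open>down\<close> of \<open>F \<tau>\<close>, and such images span
  \<open>image_up_all\<close>.\<close>

lemma image_up_subset_iff_down:
  "image_up_all D Q n H \<subseteq> ker_eval_map D F \<longleftrightarrow>
    (\<forall>i\<in>{1..n}. \<forall>\<alpha>\<in>carrier (D\<^sub>i i). \<forall>\<tau>\<in>upper_half. down\<^sub>i i (F \<tau>) \<alpha> = 0)"
proof
  assume sub: "image_up_all D Q n H \<subseteq> ker_eval_map D F"
  show "\<forall>i\<in>{1..n}. \<forall>\<alpha>\<in>carrier (D\<^sub>i i). \<forall>\<tau>\<in>upper_half. down\<^sub>i i (F \<tau>) \<alpha> = 0"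
  proof (intro ballI)
    fix i \<alpha> \<tau> assume i: "i \<in> {1..n}" and \<alpha>: "\<alpha> \<in> carrier (D\<^sub>i i)" and \<tau>: "\<tau> \<in> upper_half"
    define w where "w = (\<lambda>j\<in>{1..n}. if j = i then basis_vec \<alpha> else (\<lambda>\<alpha>. 0))"
    have "w \<in> (\<Pi>\<^sub>E i\<in>{1..n}. group_alg (D\<^sub>i i))"
      using group_alg_basis_vec[OF \<alpha>] by (auto simp: w_def group_alg_def)
    then have "up_all D Q n H w \<in> ker_eval_map D F"
      using sub unfolding image_up_all_def by blast
    moreover have "up_all D Q n H w = up\<^sub>i i (basis_vec \<alpha>)"
    proof
      fix \<gamma>
      have "up_all D Q n H w \<gamma> = (\<Sum>j=1..n. if j = i then up\<^sub>i i (basis_vec \<alpha>) \<gamma> else 0)"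
        unfolding up_all_def by (intro sum.cong refl) (simp add: w_def up_def lin_ext_def)
      then show "up_all D Q n H w \<gamma> = up\<^sub>i i (basis_vec \<alpha>) \<gamma>" using i by simp
    qed
    ultimately have "eval_map D F (up\<^sub>i i (basis_vec \<alpha>)) \<tau> = 0"
      using \<tau> by (simp add: ker_eval_map_def)
    then show "down\<^sub>i i (F \<tau>) \<alpha> = 0"
      using \<alpha> finite_D\<^sub>i[OF i] unfolding eval_map_up[OF i]
      by (simp add: basis_vec_def if_distribR if_distrib[of "\<lambda>x. x * _"] cong: if_cong)
  qed
next
  assume down: "\<forall>i\<in>{1..n}. \<forall>\<alpha>\<in>carrier (D\<^sub>i i). \<forall>\<tau>\<in>upper_half. down\<^sub>i i (F \<tau>) \<alpha> = 0"
  show "image_up_all D Q n H \<subseteq> ker_eval_map D F"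
  proof
    fix v assume "v \<in> image_up_all D Q n H"
    then obtain w where v: "v = up_all D Q n H w" unfolding image_up_all_def by blast
    have "v \<in> group_alg D"
      using up_alg by (auto simp: v up_all_def group_alg_def intro!: sum.neutral)
    moreover have "eval_map D F v \<tau> = 0" if \<tau>: "\<tau> \<in> upper_half" for \<tau>
    proof -
      have "eval_map D F v \<tau> = (\<Sum>i=1..n. eval_map D F (up\<^sub>i i (w i)) \<tau>)"
        unfolding eval_map_def lin_ext_def v up_all_def sum_distrib_right by (rule sum.swap)
      also have "\<dots> = 0" using down \<tau> by (intro sum.neutral) (simp add: eval_map_up)
      finally show ?thesis .
    qed
    ultimately show "v \<in> ker_eval_map D F" by (simp add: ker_eval_map_def)
  qed
qed

lemma down_zero_iff_sums_zero:
  "(\<forall>i\<in>{1..n}. \<forall>\<alpha>\<in>carrier (D\<^sub>i i). \<forall>\<tau>\<in>upper_half. down\<^sub>i i (F \<tau>) \<alpha> = 0) \<longleftrightarrow>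
    (\<forall>i\<in>{1..n}. \<forall>\<gamma>\<in>perp D Q (H i). \<forall>\<tau>\<in>upper_half. (\<Sum>h\<in>H i. F \<tau> (\<gamma> \<otimes> h)) = 0)"
proof (intro ball_cong refl)
  fix i assume "i \<in> {1..n}"
  then interpret isotropic_subgroup D Q "H i" by (rule isotropic_subgroup)
  show "(\<forall>\<alpha>\<in>carrier (D\<^sub>i i). \<forall>\<tau>\<in>upper_half. down\<^sub>i i (F \<tau>) \<alpha> = 0) \<longleftrightarrow>
      (\<forall>\<gamma>\<in>perp D Q (H i). \<forall>\<tau>\<in>upper_half. (\<Sum>h\<in>H i. F \<tau> (\<gamma> \<otimes> h)) = 0)"
    by (simp add: carrier_quot down_coset)
qed

text \<open>The integrands agree pointwise: adjunction moves \<open>up\<close> onto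
  \<open>F\<close>, with the conjugation carried through \<open>down\<close> by
  \<open>down_cnj\<close>.\<close>

lemma petersson_up_func_all:
  "petersson D k F (up_func_all D Q n H G) = (LINT \<tau>:fund_domain|lborel.
     (\<Sum>i=1..n. \<Sum>\<alpha>\<in>carrier (D\<^sub>i i). down\<^sub>i i (F \<tau>) \<alpha> * cnj (G i \<tau> \<alpha>)) * of_real (Im \<tau> powi k / (Im \<tau>)\<^sup>2))"
proof -
  have "(\<Sum>\<gamma>\<in>carrier D. F \<tau> \<gamma> * cnj (up_func_all D Q n H G \<tau> \<gamma>))
      = (\<Sum>i=1..n. \<Sum>\<alpha>\<in>carrier (D\<^sub>i i). down\<^sub>i i (F \<tau>) \<alpha> * cnj (G i \<tau> \<alpha>))" for \<tau>
  proof -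
    have "(\<Sum>\<gamma>\<in>carrier D. F \<tau> \<gamma> * cnj (up_func_all D Q n H G \<tau> \<gamma>))
        = cnj (eval_map D (up_func_all D Q n H G) (\<lambda>\<gamma>. cnj (F \<tau> \<gamma>)) \<tau>)"
      by (simp add: eval_map_def lin_ext_def)
    then show ?thesis by (simp add: eval_map_up_func_all down_cnj mult.commute)
  qed
  then show ?thesis by (simp add: petersson_def)
qed

lemma petersson_perp_iff_down:
  "F \<in> petersson_perp D Q k (image_up_func_all D Q k n H) \<longleftrightarrow>
    (\<forall>i\<in>{1..n}. \<forall>\<alpha>\<in>carrier (D\<^sub>i i). \<forall>\<tau>\<in>upper_half. down\<^sub>i i (F \<tau>) \<alpha> = 0)"
proof
  assume perp: "F \<in> petersson_perp D Q k (image_up_func_all D Q k n H)"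
  define G where "G = (\<lambda>i\<in>{1..n}. \<lambda>\<tau>. down\<^sub>i i (F \<tau>))"
  have "G \<in> (\<Pi>\<^sub>E i\<in>{1..n}. vv_cusp_forms (D\<^sub>i i) (quot_form Q) k)"
    unfolding G_def using down_cusp_form by simp
  then have "petersson D k F (up_func_all D Q n H G) = 0"
    using perp unfolding petersson_perp_def image_up_func_all_def by blast
  \<comment> \<open>All components of all the \<open>down\<close> images are gathered in one
    disjoint union, so that a single integral of a sum of squares treats them together.\<close>
  define X where "X = Sigma {1..n} (\<lambda>i. carrier (D\<^sub>i i))"
  define f where "f = (\<lambda>(i, \<alpha>) \<tau>. down\<^sub>i i (F \<tau>) \<alpha>)"
  have "finite X" unfolding X_def using finite_D\<^sub>i by auto
  have "(\<Sum>i=1..n. \<Sum>\<alpha>\<in>carrier (D\<^sub>i i). down\<^sub>i i (F \<tau>) \<alpha> * cnj (G i \<tau> \<alpha>))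
      = of_real (\<Sum>x\<in>X. (norm (f x \<tau>))\<^sup>2)" for \<tau>
  proof -
    have "(\<Sum>x\<in>X. (norm (f x \<tau>))\<^sup>2) = (\<Sum>i=1..n. \<Sum>\<alpha>\<in>carrier (D\<^sub>i i). (norm (down\<^sub>i i (F \<tau>) \<alpha>))\<^sup>2)"
      unfolding X_def f_def using finite_D\<^sub>i by (subst sum.Sigma) (auto simp: case_prod_unfold)
    then show ?thesis
      by (simp add: G_def complex_norm_square del: of_real_power)
  qed
  then have zero: "(LINT \<tau>:fund_domain|lborel.
      of_real ((\<Sum>x\<in>X. (norm (f x \<tau>))\<^sup>2) * (Im \<tau> powi k / (Im \<tau>)\<^sup>2))) = (0 :: complex)"
    using \<open>petersson D k F (up_func_all D Q n H G) = 0\<close> unfolding petersson_up_func_all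
    by (simp only: of_real_mult)
  have cusp_f: "\<exists>N>0. cusp_form N k (f x)" if "x \<in> X" for x
    using that down_cusp_form by (auto simp: X_def f_def vv_cusp_forms_def)
  show "\<forall>i\<in>{1..n}. \<forall>\<alpha>\<in>carrier (D\<^sub>i i). \<forall>\<tau>\<in>upper_half. down\<^sub>i i (F \<tau>) \<alpha> = 0"
  proof (intro ballI)
    fix i \<alpha> \<tau> assume "i \<in> {1..n}" "\<alpha> \<in> carrier (D\<^sub>i i)" "\<tau> \<in> upper_half"
    then show "down\<^sub>i i (F \<tau>) \<alpha> = 0"
      using sum_square_integral_zero_imp_zero[OF \<open>finite X\<close> cusp_f zero, of "(i, \<alpha>)" \<tau>]
      by (simp add: X_def f_def)
  qed
next
  assume down: "\<forall>i\<in>{1..n}. \<forall>\<alpha>\<in>carrier (D\<^sub>i i). \<forall>\<tau>\<in>upper_half. down\<^sub>i i (F \<tau>) \<alpha> = 0"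
  have "petersson D k F (up_func_all D Q n H G) = 0" for G
  proof -
    \<comment> \<open>In this direction the integrand itself vanishes throughout
      \<open>fund_domain\<close>, so no convergence question arises.\<close>
    have "(\<Sum>i=1..n. \<Sum>\<alpha>\<in>carrier (D\<^sub>i i). down\<^sub>i i (F \<tau>) \<alpha> * cnj (G i \<tau> \<alpha>)) = 0" if "\<tau> \<in> upper_half" for \<tau>
      using down that by (intro sum.neutral) simp
    then have "petersson D k F (up_func_all D Q n H G) = (LINT \<tau>:fund_domain|lborel. 0)"
      unfolding petersson_up_func_all by (intro set_lebesgue_integral_cong) (auto simp: fund_domain_def)
    then show ?thesis by (simp add: set_lebesgue_integral_def)
  qed
  then show "F \<in> petersson_perp D Q k (image_up_func_all D Q k n H)"
    using cusp by (auto simp: petersson_perp_def image_up_func_all_def)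
qed

end

theorem theorem5p2:
  fixes D :: "('a, 'b) monoid_scheme" and Q :: "'a \<Rightarrow> qmodz" and s k :: int
    and n :: nat and H :: "nat \<Rightarrow> 'a set" and F :: "complex \<Rightarrow> 'a \<Rightarrow> complex"
  assumes "discriminant_form D Q"
    and "has_signature D Q s" and "even s"
    and "\<And>i. i \<in> {1..n} \<Longrightarrow> isotropic D Q (H i)"
    and "F \<in> vv_cusp_forms D Q k"
  shows "(F \<in> oldforms D Q k n H \<longleftrightarrow> F \<in> image_up_func_all D Q k n H) \<and>
         (F \<in> image_up_func_all D Q k n H \<longleftrightarrow> ker_down_all D Q n H \<subseteq> ker_eval_map D F) \<and>
         (F \<in> newforms D Q k n H \<longleftrightarrow> F \<in> petersson_perp D Q k (image_up_func_all D Q k n H)) \<and>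
         (F \<in> petersson_perp D Q k (image_up_func_all D Q k n H) \<longleftrightarrow>
            image_up_all D Q n H \<subseteq> ker_eval_map D F) \<and>
         (image_up_all D Q n H \<subseteq> ker_eval_map D F \<longleftrightarrow>
            (\<forall>i\<in>{1..n}. \<forall>\<gamma>\<in>perp D Q (H i). \<forall>\<tau>\<in>upper_half.
               (\<Sum>h\<in>H i. F \<tau> (\<gamma> \<otimes>\<^bsub>D\<^esub> h)) = 0))"
proof -
  interpret isotropic_family_cusp_form D Q n H k F
    using assms by (intro isotropic_family_cusp_form.intro isotropic_family.intro
        isotropic_family_axioms.intro isotropic_family_cusp_form_axioms.intro)
  show ?thesis
    unfolding newforms_def oldforms_eq_image
    using in_image_iff petersson_perp_iff_down image_up_subset_iff_down down_zero_iff_sums_zero by blast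
qed

end
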